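(* Let $(W,S)$ be a right-angled Coxeter system and let $\mathbf{q}=(q_s)_{s\in S}\in(0,1]^S$. Let $\mathcal{C}$ be the set of cliques of the commutation graph of $(W,S)$. The trace pairing of $K_0(C^*_{\mathbf{q}}(W))$ with the natural trace $\tau$ is given by $$\tau_*([p_C])=\prod_{s\in C}\frac{1}{1+q_s}\qquad\text{for all } C\in\mathcal{C}.$$
   Context: Right-angled Coxeter systems: let $S$ be a non-empty finite set and $M=(m_{st})_{s,t\in S}$ a symmetric matrix with $m_{ss}=1$ and $m_{st}\in\{2,\infty\}$ for $s\neq t$. The associated right-angled Coxeter system $(W,S)$ is the group $W=\langle S \mid s^2=e \text{ for all } s\in S,\ st=ts \text{ whenever } m_{st}=2\rangle$ together with $S$. Write $|w|$ for word length with respect to $S$. The commutation graph has vertex set $S$, with distinct $s,t$ joined by an edge iff $m_{st}=2$. A clique is a complete subgraph (identified with its vertex set); the empty set is a clique. Hecke C*-algebras: let $\lambda_{\mathbf{q}}:W\to B(\ell^2(W))$ be the unitary representation determined, for $s\in S$ and $w\in W$, by $$\lambda_{\mathbf{q}}(s)\delta_w=\begin{cases}\frac{1-q_s}{1+q_s}\delta_w+\frac{2q_s^{1/2}}{1+q_s}\delta_{sw} & \text{if } |sw|>|w|,\\ -\frac{1-q_s}{1+q_s}\delta_w+\frac{2q_s^{1/2}}{1+q_s}\delta_{sw} & \text{if } |sw|<|w|.\end{cases}$$ $C^*_{\mathbf{q}}(W)$ is the C*-algebra generated by $\lambda_{\mathbf{q}}(W)$. The natural trace is $\tau(x)=\langle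 x\delta_e,\delta_e\rangle$, and $\tau_*:K_0(C^*_{\mathbf{q}}(W))\to\mathbb{R}$ is the induced homomorphism. Clique projections: for $s\in S$ let $\chi_1^{(s)}=\frac12(1+\lambda_{\mathbf{q}}(s))$. For a clique $C$ the projections $\chi_1^{(s)}$, $s\in C$, commute; put $p_C=\prod_{s\in C}\chi_1^{(s)}$ and $p_\emptyset=1$. The classes $[p_C]$, $C\in\mathcal{C}$, form a basis of $K_0(C^*_{\mathbf{q}}(W))$. *)

theory Defs
  imports "HOL-Analysis.Analysis" "HOL-Algebra.Ring" "HOL-Library.Extended_Nat"
begin

section \<open>Groups given by generators and relations\<close>

text \<open>The letter \<open>(s, True)\<close> stands for the generator \<open>s\<close> and \<open>(s, False)\<close> for its formal inverse.
  A relation \<open>x = y\<close> is a pair \<open>(x, y)\<close> of words.\<close>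

type_synonym 'a word = "('a \<times> bool) list"

definition words :: "'a set \<Rightarrow> 'a word set" where
  "words S = lists (S \<times> UNIV)"

inductive pres_eq :: "'a set \<Rightarrow> ('a word \<times> 'a word) set \<Rightarrow> 'a word \<Rightarrow> 'a word \<Rightarrow> bool"
  for S R where
  refl: "u \<in> words S \<Longrightarrow> pres_eq S R u u"
| sym: "pres_eq S R u v \<Longrightarrow> pres_eq S R v u"
| trans: "pres_eq S R u v \<Longrightarrow> pres_eq S R v w \<Longrightarrow> pres_eq S R u w"
| cancel: "u \<in> words S \<Longrightarrow> v \<in> words S \<Longrightarrow> s \<in> S \<Longrightarrow>
    pres_eq S R (u @ [(s, b), (s, \<not> b)] @ v) (u @ v)"
| relation: "u \<in> words S \<Longrightarrow> v \<in> words S \<Longrightarrow> (x, y) \<in> R \<Longrightarrow> x \<in> words S \<Longrightarrow> y \<in> words S \<Longrightarrow>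
    pres_eq S R (u @ x @ v) (u @ y @ v)"

definition word_class :: "'a set \<Rightarrow> ('a word \<times> 'a word) set \<Rightarrow> 'a word \<Rightarrow> 'a word set" where
  "word_class S R u = {v. pres_eq S R u v}"

definition presented_group ::
    "'a set \<Rightarrow> ('a word \<times> 'a word) set \<Rightarrow> 'a word set monoid" where
  "presented_group S R =
     \<lparr> carrier = word_class S R ` words S,
       mult = (\<lambda>X Y. {w. \<exists>u\<in>X. \<exists>v\<in>Y. pres_eq S R (u @ v) w}),
       one = word_class S R [] \<rparr>"

text \<open>Elements of a presented group are classes of words, so the word length of an element is the
  length of a shortest word in it.\<close>

definition word_length :: "'a word set \<Rightarrow> nat" where
  "word_length w = (LEAST n. \<exists>u\<in>w. length u = n)"


section \<open>Right-angled Coxeter systems\<close>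

definition right_angled_coxeter_matrix :: "'a set \<Rightarrow> ('a \<Rightarrow> 'a \<Rightarrow> enat) \<Rightarrow> bool" where
  "right_angled_coxeter_matrix S m \<longleftrightarrow>
     finite S \<and> S \<noteq> {} \<and>
     (\<forall>s\<in>S. \<forall>t\<in>S. m s t = m t s) \<and>
     (\<forall>s\<in>S. m s s = 1) \<and>
     (\<forall>s\<in>S. \<forall>t\<in>S. s \<noteq> t \<longrightarrow> m s t = 2 \<or> m s t = \<infinity>)"

definition racg_relations :: "'a set \<Rightarrow> ('a \<Rightarrow> 'a \<Rightarrow> enat) \<Rightarrow> ('a word \<times> 'a word) set" where
  "racg_relations S m =
     {([(s, True), (s, True)], []) | s. s \<in> S} \<union>
     {([(s, True), (t, True)], [(t, True), (s, True)]) | s t. s \<in> S \<and> t \<in> S \<and> m s t = 2}"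

definition racg :: "'a set \<Rightarrow> ('a \<Rightarrow> 'a \<Rightarrow> enat) \<Rightarrow> 'a word set monoid" where
  "racg S m = presented_group S (racg_relations S m)"

definition racg_gen :: "'a set \<Rightarrow> ('a \<Rightarrow> 'a \<Rightarrow> enat) \<Rightarrow> 'a \<Rightarrow> 'a word set" where
  "racg_gen S m s = word_class S (racg_relations S m) [(s, True)]"

definition commutation_edge :: "'a set \<Rightarrow> ('a \<Rightarrow> 'a \<Rightarrow> enat) \<Rightarrow> 'a \<Rightarrow> 'a \<Rightarrow> bool" where
  "commutation_edge S m s t \<longleftrightarrow> s \<in> S \<and> t \<in> S \<and> s \<noteq> t \<and> m s t = 2"

definition cliques :: "'a set \<Rightarrow> ('a \<Rightarrow> 'a \<Rightarrow> enat) \<Rightarrow> 'a set set" where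
  "cliques S m = {C. C \<subseteq> S \<and> (\<forall>s\<in>C. \<forall>t\<in>C. s \<noteq> t \<longrightarrow> commutation_edge S m s t)}"


section \<open>Bounded operators on \<open>\<ell>\<^sup>2(I)\<close>\<close>

text \<open>The inner product is linear in the first argument.\<close>

definition ell2 :: "'i set \<Rightarrow> ('i \<Rightarrow> complex) set" where
  "ell2 I = {f. (\<forall>i. i \<notin> I \<longrightarrow> f i = 0) \<and> (\<lambda>i. (cmod (f i))\<^sup>2) summable_on I}"

definition ell2_inner :: "'i set \<Rightarrow> ('i \<Rightarrow> complex) \<Rightarrow> ('i \<Rightarrow> complex) \<Rightarrow> complex" where
  "ell2_inner I f g = (\<Sum>\<^sub>\<infinity>i\<in>I. f i * cnj (g i))"

definition ell2_norm :: "'i set \<Rightarrow> ('i \<Rightarrow> complex) \<Rightarrow> real" where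
  "ell2_norm I f = sqrt (\<Sum>\<^sub>\<infinity>i\<in>I. (cmod (f i))\<^sup>2)"

definition delta :: "'i \<Rightarrow> 'i \<Rightarrow> complex" where
  "delta i = (\<lambda>j. if j = i then 1 else 0)"

type_synonym 'i operator = "('i \<Rightarrow> complex) \<Rightarrow> ('i \<Rightarrow> complex)"

text \<open>An operator is represented by a total function that is \<open>0\<close> outside \<open>ell2 I\<close>, so that
  equality of functions is equality of operators.\<close>

definition bounded_op :: "'i set \<Rightarrow> 'i operator \<Rightarrow> bool" where
  "bounded_op I T \<longleftrightarrow>
     (\<forall>f\<in>ell2 I. T f \<in> ell2 I) \<and>
     (\<forall>f. f \<notin> ell2 I \<longrightarrow> T f = (\<lambda>i. 0)) \<and>
     (\<forall>f\<in>ell2 I. \<forall>g\<in>ell2 I. T (\<lambda>i. f i + g i) = (\<lambda>i. T f i + T g i)) \<and>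
     (\<forall>c. \<forall>f\<in>ell2 I. T (\<lambda>i. c * f i) = (\<lambda>i. c * T f i)) \<and>
     (\<exists>K. \<forall>f\<in>ell2 I. ell2_norm I (T f) \<le> K * ell2_norm I f)"

definition op_adjoint :: "'i set \<Rightarrow> 'i operator \<Rightarrow> 'i operator" where
  "op_adjoint I T = (THE U. bounded_op I U \<and>
     (\<forall>f\<in>ell2 I. \<forall>g\<in>ell2 I. ell2_inner I (T f) g = ell2_inner I f (U g)))"

definition op_scale :: "complex \<Rightarrow> 'i operator \<Rightarrow> 'i operator" where
  "op_scale c T = (\<lambda>f i. c * T f i)"

definition op_norm :: "'i set \<Rightarrow> 'i operator \<Rightarrow> real" where
  "op_norm I T = (SUP f\<in>{f \<in> ell2 I. ell2_norm I f \<le> 1}. ell2_norm I (T f))"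

record 'b star_ring = "'b ring" +
  star :: "'b \<Rightarrow> 'b"

definition bounded_ops :: "'i set \<Rightarrow> 'i operator star_ring" where
  "bounded_ops I =
     \<lparr> carrier = {T. bounded_op I T},
       mult = (\<lambda>T U f. T (U f)),
       one = (\<lambda>f. if f \<in> ell2 I then f else (\<lambda>i. 0)),
       zero = (\<lambda>f i. 0),
       add = (\<lambda>T U f i. T f i + U f i),
       star = op_adjoint I \<rparr>"

definition unitary_group :: "'i set \<Rightarrow> 'i operator monoid" where
  "unitary_group I = (let B = bounded_ops I in
     \<lparr> carrier = {U \<in> carrier B. star B U \<otimes>\<^bsub>B\<^esub> U = \<one>\<^bsub>B\<^esub> \<and> U \<otimes>\<^bsub>B\<^esub> star B U = \<one>\<^bsub>B\<^esub>},
       mult = mult B, one = one B \<rparr>)"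

definition is_cstar_subalgebra :: "'i set \<Rightarrow> 'i operator set \<Rightarrow> bool" where
  "is_cstar_subalgebra I A \<longleftrightarrow> (let B = bounded_ops I in
     A \<subseteq> carrier B \<and> \<zero>\<^bsub>B\<^esub> \<in> A \<and>
     (\<forall>T\<in>A. \<forall>U\<in>A. T \<oplus>\<^bsub>B\<^esub> U \<in> A \<and> T \<otimes>\<^bsub>B\<^esub> U \<in> A) \<and>
     (\<forall>c. \<forall>T\<in>A. op_scale c T \<in> A) \<and>
     (\<forall>T\<in>A. star B T \<in> A) \<and>
     (\<forall>X T. (\<forall>n::nat. X n \<in> A) \<longrightarrow> T \<in> carrier B \<longrightarrow>
        (\<lambda>n. op_norm I (X n \<oplus>\<^bsub>B\<^esub> op_scale (- 1) T)) \<longlonglongrightarrow> 0 \<longrightarrow> T \<in> A))"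

definition cstar_generated :: "'i set \<Rightarrow> 'i operator set \<Rightarrow> 'i operator star_ring" where
  "cstar_generated I X =
     (bounded_ops I)\<lparr> carrier := \<Inter>{A. is_cstar_subalgebra I A \<and> X \<subseteq> A} \<rparr>"


section \<open>\<open>K\<^sub>0\<close> of a unital C*-algebra\<close>

text \<open>Only the underlying unital *-ring of the C*-algebra enters. An \<open>m \<times> n\<close> matrix is a function
  of two indices that is \<open>\<zero>\<close> outside the index range, and a projection of size \<open>n\<close> is recorded
  together with \<open>n\<close>.\<close>

type_synonym 'b sqmat = "nat \<times> (nat \<Rightarrow> nat \<Rightarrow> 'b)"

definition mats :: "('b, 'c) star_ring_scheme \<Rightarrow> nat \<Rightarrow> nat \<Rightarrow> (nat \<Rightarrow> nat \<Rightarrow> 'b) set" where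
  "mats A m n = {x. (\<forall>i<m. \<forall>j<n. x i j \<in> carrier A) \<and>
                    (\<forall>i j. \<not> (i < m \<and> j < n) \<longrightarrow> x i j = \<zero>\<^bsub>A\<^esub>)}"

definition mats_mult :: "('b, 'c) star_ring_scheme \<Rightarrow> nat \<Rightarrow>
    (nat \<Rightarrow> nat \<Rightarrow> 'b) \<Rightarrow> (nat \<Rightarrow> nat \<Rightarrow> 'b) \<Rightarrow> (nat \<Rightarrow> nat \<Rightarrow> 'b)" where
  "mats_mult A n x y = (\<lambda>i j. \<Oplus>\<^bsub>A\<^esub>k\<in>{..<n}. x i k \<otimes>\<^bsub>A\<^esub> y k j)"

definition mats_star :: "('b, 'c) star_ring_scheme \<Rightarrow>
    (nat \<Rightarrow> nat \<Rightarrow> 'b) \<Rightarrow> (nat \<Rightarrow> nat \<Rightarrow> 'b)" where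
  "mats_star A x = (\<lambda>i j. star A (x j i))"

definition proj_mats :: "('b, 'c) star_ring_scheme \<Rightarrow> 'b sqmat set" where
  "proj_mats A = {(n, p). p \<in> mats A n n \<and> mats_star A p = p \<and> mats_mult A n p p = p}"

text \<open>Murray--von Neumann equivalence of projections of possibly different sizes.\<close>

definition mvn_equiv :: "('b, 'c) star_ring_scheme \<Rightarrow> 'b sqmat \<Rightarrow> 'b sqmat \<Rightarrow> bool" where
  "mvn_equiv A P Q \<longleftrightarrow> (\<exists>v \<in> mats A (fst Q) (fst P).
     mats_mult A (fst Q) (mats_star A v) v = snd P \<and>
     mats_mult A (fst P) v (mats_star A v) = snd Q)"

definition diag_sum :: "('b, 'c) star_ring_scheme \<Rightarrow> 'b sqmat \<Rightarrow> 'b sqmat \<Rightarrow> 'b sqmat" where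
  "diag_sum A P Q = (fst P + fst Q,
     (\<lambda>i j. if i < fst P \<and> j < fst P then snd P i j
            else if fst P \<le> i \<and> fst P \<le> j then snd Q (i - fst P) (j - fst P)
            else \<zero>\<^bsub>A\<^esub>))"

definition zero_proj :: "('b, 'c) star_ring_scheme \<Rightarrow> 'b sqmat" where
  "zero_proj A = (0, \<lambda>i j. \<zero>\<^bsub>A\<^esub>)"

text \<open>\<open>K0 A\<close> is the Grothendieck group of the monoid of equivalence classes of projections: the pair
  \<open>(P, Q)\<close> represents the formal difference of \<open>P\<close> and \<open>Q\<close>.\<close>

definition K0_diff :: "('b, 'c) star_ring_scheme \<Rightarrow> 'b sqmat \<times> 'b sqmat \<Rightarrow>
    ('b sqmat \<times> 'b sqmat) set" where
  "K0_diff A = (\<lambda>(P, Q). {(P', Q'). P' \<in> proj_mats A \<and> Q' \<in> proj_mats A \<and>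
     (\<exists>R \<in> proj_mats A. mvn_equiv A (diag_sum A (diag_sum A P Q') R)
                                    (diag_sum A (diag_sum A P' Q) R))})"

definition K0 :: "('b, 'c) star_ring_scheme \<Rightarrow> ('b sqmat \<times> 'b sqmat) set monoid" where
  "K0 A =
     \<lparr> carrier = K0_diff A ` (proj_mats A \<times> proj_mats A),
       mult = (\<lambda>x y. \<Union>(P, Q)\<in>x. \<Union>(P', Q')\<in>y. K0_diff A (diag_sum A P P', diag_sum A Q Q')),
       one = K0_diff A (zero_proj A, zero_proj A) \<rparr>"

definition K0_class :: "('b, 'c) star_ring_scheme \<Rightarrow> 'b sqmat \<Rightarrow> ('b sqmat \<times> 'b sqmat) set" where
  "K0_class A P = K0_diff A (P, zero_proj A)"

text \<open>An element of the algebra as a \<open>1 \<times> 1\<close> matrix.\<close>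

definition mat1 :: "('b, 'c) star_ring_scheme \<Rightarrow> 'b \<Rightarrow> 'b sqmat" where
  "mat1 A a = (1, \<lambda>i j. if i = 0 \<and> j = 0 then a else \<zero>\<^bsub>A\<^esub>)"

definition mat_trace :: "('b \<Rightarrow> complex) \<Rightarrow> 'b sqmat \<Rightarrow> complex" where
  "mat_trace \<tau> P = (\<Sum>i<fst P. \<tau> (snd P i i))"

text \<open>The homomorphism induced by a positive trace \<open>\<tau>\<close>, sending \<open>[P] - [Q]\<close> to \<open>\<tau>(P) - \<tau>(Q)\<close>. The value
  is characterised by all representatives of the class at once, so it is meaningful only where
  \<open>\<tau>(P) - \<tau>(Q)\<close> is real and independent of the representative.\<close>

definition K0_trace :: "('b, 'c) star_ring_scheme \<Rightarrow> ('b \<Rightarrow> complex) \<Rightarrow>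
    ('b sqmat \<times> 'b sqmat) set \<Rightarrow> real" where
  "K0_trace A \<tau> = (\<lambda>x\<in>carrier (K0 A).
     THE r. \<forall>(P, Q)\<in>x. complex_of_real r = mat_trace \<tau> P - mat_trace \<tau> Q)"


section \<open>Right-angled Hecke C*-algebras\<close>

definition is_hecke_rep :: "'a set \<Rightarrow> ('a \<Rightarrow> 'a \<Rightarrow> enat) \<Rightarrow> ('a \<Rightarrow> real) \<Rightarrow>
    ('a word set \<Rightarrow> 'a word set operator) \<Rightarrow> bool" where
  "is_hecke_rep S m q \<pi> \<longleftrightarrow> (let W = racg S m in
     \<pi> \<in> hom W (unitary_group (carrier W)) \<and> \<pi> \<in> extensional (carrier W) \<and>
     (\<forall>s\<in>S. \<forall>w\<in>carrier W. let sw = racg_gen S m s \<otimes>\<^bsub>W\<^esub> w in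
        (word_length sw > word_length w \<longrightarrow>
          \<pi> (racg_gen S m s) (delta w) =
            (\<lambda>v. of_real ((1 - q s) / (1 + q s)) * delta w v
               + of_real (2 * sqrt (q s) / (1 + q s)) * delta sw v)) \<and>
        (word_length sw < word_length w \<longrightarrow>
          \<pi> (racg_gen S m s) (delta w) =
            (\<lambda>v. - of_real ((1 - q s) / (1 + q s)) * delta w v
               + of_real (2 * sqrt (q s) / (1 + q s)) * delta sw v))))"

definition hecke_rep :: "'a set \<Rightarrow> ('a \<Rightarrow> 'a \<Rightarrow> enat) \<Rightarrow> ('a \<Rightarrow> real) \<Rightarrow>
    'a word set \<Rightarrow> 'a word set operator" where
  "hecke_rep S m q = (THE \<pi>. is_hecke_rep S m q \<pi>)"

definition hecke_cstar :: "'a set \<Rightarrow> ('a \<Rightarrow> 'a \<Rightarrow> enat) \<Rightarrow> ('a \<Rightarrow> real) \<Rightarrow>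
    'a word set operator star_ring" where
  "hecke_cstar S m q =
     cstar_generated (carrier (racg S m)) (hecke_rep S m q ` carrier (racg S m))"

definition natural_trace :: "'a set \<Rightarrow> ('a \<Rightarrow> 'a \<Rightarrow> enat) \<Rightarrow> 'a word set operator \<Rightarrow> complex" where
  "natural_trace S m x = (let W = racg S m in
     ell2_inner (carrier W) (x (delta \<one>\<^bsub>W\<^esub>)) (delta \<one>\<^bsub>W\<^esub>))"

definition chi1 :: "'a set \<Rightarrow> ('a \<Rightarrow> 'a \<Rightarrow> enat) \<Rightarrow> ('a \<Rightarrow> real) \<Rightarrow> 'a \<Rightarrow> 'a word set operator" where
  "chi1 S m q s = (let A = hecke_cstar S m q in
     op_scale (1/2) (\<one>\<^bsub>A\<^esub> \<oplus>\<^bsub>A\<^esub> hecke_rep S m q (racg_gen S m s)))"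

text \<open>Although the algebra is not commutative, \<open>finprod\<close> is the intended product here: it folds
  multiplication over \<open>C\<close>, and the factors commute when \<open>C\<close> is a clique.\<close>

definition clique_proj :: "'a set \<Rightarrow> ('a \<Rightarrow> 'a \<Rightarrow> enat) \<Rightarrow> ('a \<Rightarrow> real) \<Rightarrow> 'a set \<Rightarrow>
    'a word set operator" where
  "clique_proj S m q C = finprod (hecke_cstar S m q) (chi1 S m q) C"

end

theory Submission
  imports Defs
begin

text \<open>By construction \<open>K0_trace\<close> takes the value \<open>r\<close> on \<open>[P]\<close> as soon as every formal difference
\<open>[P'] - [Q']\<close> equal to \<open>[P]\<close> satisfies \<open>\<tau>(P') - \<tau>(Q') = r\<close>. So two things are needed: \<open>\<tau>\<close> is a trace
on the Hecke C*-algebra, which makes \<open>\<tau>(P)\<close> invariant under Murray--von Neumann equivalence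
(\<open>mvn_trace\<close>), and \<open>\<tau>(p\<^sub>C)\<close> is the stated product (\<open>clique_proj_props\<close>).

Everything rests on the combinatorics of the group. The word problem is solved by letting the
generators act on families of stacks: for each pair \<open>{a, b}\<close> of equal or non-commuting generators
keep the letters of a word lying in \<open>{a, b}\<close>. A generator \<open>s\<close> is removed from the stacks that
concern it if it lies on top of all of them, and is put on top of all of them otherwise. This action
respects the defining relations. It shows that a word of minimal length representing an element
shortened by \<open>s\<close> has the form \<open>a @ s # b\<close> with \<open>s\<close> commuting with all letters of \<open>a\<close>
(\<open>descent_split\<close>). The exchange properties used later are read off from this form: if
\<open>st = ts\<close> then \<open>t\<close> does not affect whether \<open>s\<close> shortens an element (\<open>up_commuting\<close>), and right
multiplication of \<open>w\<close> by \<open>t\<close> changes whether \<open>s\<close> shortens it only if \<open>s = t\<close> and \<open>sw = wt\<close>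
(\<open>up_rmult\<close>). The first one makes the formula for the Hecke representation well defined on the
group. The second one makes the operators \<open>T s\<close> of the representation commute with their
mirror images \<open>R t\<close>, which act by right multiplication (\<open>T_R\<close>).

For traciality, every element \<open>x\<close> of the algebra commutes with all \<open>R t\<close>. Along a reduced word, the
\<open>R t\<close> carry \<open>\<delta>\<^sub>e\<close> to \<open>\<delta>\<^sub>w\<close> up to scalars and lower terms, whence \<open>(x \<delta>\<^sub>w)(e) = (x \<delta>\<^sub>e)(w\<inverse>)\<close>
(\<open>right_commutant_winv\<close>). Therefore \<open>\<tau>(xy) = \<Sum>\<^sub>w (y \<delta>\<^sub>e)(w) (x \<delta>\<^sub>e)(w\<inverse>)\<close>, and the substitution
\<open>w \<mapsto> w\<inverse>\<close> exchanges \<open>x\<close> and \<open>y\<close>.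

The value \<open>\<tau>(p\<^sub>C)\<close> follows by induction on \<open>C\<close>. For \<open>s \<notin> C\<close> the vector \<open>p\<^sub>C \<delta>\<^sub>e\<close> vanishes at \<open>s\<close>,
because it is supported on the subgroup generated by \<open>C\<close>, so applying \<open>\<chi>\<^sub>s\<close> multiplies its
value at \<open>e\<close> by \<open>(1 + (1 - q\<^sub>s) / (1 + q\<^sub>s)) / 2 = 1 / (1 + q\<^sub>s)\<close>.\<close>

section \<open>Words and the presented group\<close>

(* Keeps membership in lists S intact, the form in which the simplification rules below expect it. *)
declare in_listsD [rule del] in_listsI [rule del]

lemma rev_in_lists [simp]: "rev v \<in> lists S \<longleftrightarrow> v \<in> lists S"
  by (simp add: in_lists_conv_set)

lemma words_Nil [simp]: "[] \<in> words S" by (simp add: words_def)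
lemma words_Cons [simp]: "x # u \<in> words S \<longleftrightarrow> fst x \<in> S \<and> u \<in> words S"
  by (cases x) (auto simp: words_def)
lemma words_append [simp]: "u @ v \<in> words S \<longleftrightarrow> u \<in> words S \<and> v \<in> words S"
  by (auto simp: words_def)
lemma words_rev [simp]: "rev u \<in> words S \<longleftrightarrow> u \<in> words S"
  by (auto simp: words_def)

lemma pres_eq_words: "pres_eq S R u v \<Longrightarrow> u \<in> words S \<and> v \<in> words S"
  by (induction rule: pres_eq.induct) auto

lemma pres_eq_context:
  "pres_eq S R u v \<Longrightarrow> a \<in> words S \<Longrightarrow> b \<in> words S \<Longrightarrow> pres_eq S R (a @ u @ b) (a @ v @ b)"
proof (induction rule: pres_eq.induct)
  case (cancel u v s c)
  then show ?case using pres_eq.cancel[of "a @ u" S "v @ b" s R c] by simp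
next
  case (relation u v x y)
  then show ?case using pres_eq.relation[of "a @ u" S "v @ b" x y R] by simp
qed (auto intro: pres_eq.intros)

lemma pres_eq_append:
  assumes "pres_eq S R u u'" "pres_eq S R v v'"
  shows "pres_eq S R (u @ v) (u' @ v')"
proof -
  have w: "u \<in> words S" "u' \<in> words S" "v \<in> words S" "v' \<in> words S"
    using assms pres_eq_words by blast+
  have "pres_eq S R (u @ v) (u' @ v)" using pres_eq_context[OF assms(1), of "[]" v] w by simp
  moreover have "pres_eq S R (u' @ v) (u' @ v')"
    using pres_eq_context[OF assms(2), of u' "[]"] w by simp
  ultimately show ?thesis by (rule pres_eq.trans)
qed

text \<open>The word spelled by a list of generators, without formal inverses. Since \<open>s\<^sup>2 = e\<close>, every group
element is represented by such a word.\<close>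

definition emb :: "'a list \<Rightarrow> 'a word" where
  "emb v = map (\<lambda>s. (s, True)) v"

lemma emb_simps [simp]: "emb [] = []" "emb (s # v) = (s, True) # emb v"
  "emb (u @ v) = emb u @ emb v" "rev (emb u) = emb (rev u)" "map fst (emb v) = v"
  "length (emb v) = length v"
  by (simp_all add: emb_def rev_map comp_def)

lemma emb_words [simp]: "emb v \<in> words S \<longleftrightarrow> v \<in> lists S"
  by (induction v) auto

lemma fst_words: "u \<in> words S \<Longrightarrow> map fst u \<in> lists S"
  by (induction u) auto

locale right_angled =
  fixes S :: "'a set" and m :: "'a \<Rightarrow> 'a \<Rightarrow> enat"
  assumes racm: "right_angled_coxeter_matrix S m"
begin

text \<open>Equality of words in the group.\<close>

abbreviation "weq \<equiv> pres_eq S (racg_relations S m)"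

text \<open>The group element represented by a list of generators.\<close>

definition cls :: "'a list \<Rightarrow> 'a word set" where
  "cls v = word_class S (racg_relations S m) (emb v)"

definition commuting :: "'a \<Rightarrow> 'a \<Rightarrow> bool" where
  "commuting s t \<longleftrightarrow> s \<in> S \<and> t \<in> S \<and> m s t = 2"

lemma finS: "finite S" and neS: "S \<noteq> {}"
  and m_sym: "s \<in> S \<Longrightarrow> t \<in> S \<Longrightarrow> m s t = m t s"
  and m_diag: "s \<in> S \<Longrightarrow> m s s = 1"
  using racm unfolding right_angled_coxeter_matrix_def by metis+

lemma commuting_irrefl: "\<not> commuting s s"
  using m_diag by (auto simp: commuting_def one_eq_numeral_iff)

lemma commuting_sym: "commuting s t \<Longrightarrow> commuting t s"
  using m_sym by (auto simp: commuting_def)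

lemma weq_square: "s \<in> S \<Longrightarrow> weq [(s, True), (s, True)] []"
  using pres_eq.relation[of "[]" S "[]" "[(s, True), (s, True)]" "[]" "racg_relations S m"]
  by (auto simp: racg_relations_def)

lemma weq_commuting: "commuting s t \<Longrightarrow> weq [(s, True), (t, True)] [(t, True), (s, True)]"
  using pres_eq.relation[of "[]" S "[]" "[(s, True), (t, True)]" "[(t, True), (s, True)]" "racg_relations S m"]
  by (auto simp: racg_relations_def commuting_def)

lemma weq_letter: assumes "s \<in> S" shows "weq [(s, b)] [(s, True)]"
proof (cases b)
  case False
  have "weq ([(s, True), (s, True)] @ [(s, False)]) ([] @ [(s, False)])"
    using assms by (intro pres_eq_append weq_square pres_eq.refl) auto
  moreover have "weq ([(s, True)] @ [(s, True), (s, \<not> True)] @ []) ([(s, True)] @ [])"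
    using assms by (intro pres_eq.cancel) auto
  ultimately show ?thesis using False pres_eq.sym pres_eq.trans by fastforce
qed (use assms in \<open>auto intro: pres_eq.refl\<close>)

lemma weq_emb: "u \<in> words S \<Longrightarrow> weq u (emb (map fst u))"
proof (induction u)
  case (Cons x u)
  then have "weq ([x] @ u) ([(fst x, True)] @ emb (map fst u))"
    by (intro pres_eq_append) (auto intro: weq_letter[of "fst x" "snd x", simplified])
  then show ?case by simp
qed (auto intro: pres_eq.refl)

lemma word_class_eq_iff:
  assumes "u \<in> words S"
  shows "word_class S (racg_relations S m) u = word_class S (racg_relations S m) v \<longleftrightarrow> weq u v"
  using assms unfolding word_class_def by (blast intro: pres_eq.intros)

lemma cls_eq_iff: "v \<in> lists S \<Longrightarrow> cls u = cls v \<longleftrightarrow> weq (emb u) (emb v)"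
  using word_class_eq_iff[of "emb v" "emb u"] unfolding cls_def
  by (metis emb_words pres_eq.sym)

lemma carrier_racg: "carrier (racg S m) = cls ` lists S"
proof -
  have "word_class S (racg_relations S m) u \<in> cls ` lists S" if "u \<in> words S" for u
    using weq_emb[OF that] fst_words[OF that] that word_class_eq_iff unfolding cls_def by blast
  then show ?thesis
    by (force simp: racg_def presented_group_def cls_def)
qed

lemma cls_carrier [simp]: "v \<in> lists S \<Longrightarrow> cls v \<in> carrier (racg S m)"
  by (simp add: carrier_racg)

lemma carrier_cases:
  assumes "w \<in> carrier (racg S m)" obtains v where "v \<in> lists S" "w = cls v"
  using assms by (auto simp: carrier_racg)

lemma racg_one: "\<one>\<^bsub>racg S m\<^esub> = cls []"
  by (simp add: racg_def presented_group_def cls_def)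

lemma racg_gen_cls: "racg_gen S m s = cls [s]"
  by (simp add: racg_gen_def cls_def)

lemma racg_mult:
  assumes "u \<in> lists S" "v \<in> lists S"
  shows "cls u \<otimes>\<^bsub>racg S m\<^esub> cls v = cls (u @ v)"
proof -
  have "weq (x @ y) w \<Longrightarrow> weq (emb u) x \<Longrightarrow> weq (emb v) y \<Longrightarrow> weq (emb u @ emb v) w" for x y w
    using pres_eq_append pres_eq.trans by metis
  moreover have "weq (emb u) (emb u)" "weq (emb v) (emb v)"
    using assms by (auto intro: pres_eq.refl)
  ultimately show ?thesis
    unfolding racg_def presented_group_def cls_def word_class_def by auto
qed

section \<open>The word problem and reduced words\<close>

text \<open>The stacks are indexed by ordered pairs \<open>(a, b)\<close> of equal or non-commuting generators; those at
other pairs stay empty. Generator \<open>s\<close> occurs in the stacks at the pairs that contain it. The pair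
\<open>(s, s)\<close> is among them because \<open>m s s = 1\<close>.\<close>

definition touched :: "'a \<Rightarrow> 'a \<Rightarrow> 'a \<Rightarrow> bool" where
  "touched s a b \<longleftrightarrow> a \<in> S \<and> b \<in> S \<and> m a b \<noteq> 2 \<and> (s = a \<or> s = b)"

text \<open>\<open>s\<close> lies on top of every stack in which it can occur.\<close>

definition descent :: "'a \<Rightarrow> ('a \<Rightarrow> 'a \<Rightarrow> 'a list) \<Rightarrow> bool" where
  "descent s F \<longleftrightarrow> (\<forall>a b. touched s a b \<longrightarrow> F a b \<noteq> [] \<and> hd (F a b) = s)"

text \<open>Putting \<open>s\<close> on top of every stack in which it can occur.\<close>

definition push :: "'a \<Rightarrow> ('a \<Rightarrow> 'a \<Rightarrow> 'a list) \<Rightarrow> 'a \<Rightarrow> 'a \<Rightarrow> 'a list" where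
  "push s F = (\<lambda>a b. if touched s a b then s # F a b else F a b)"

text \<open>Removing the top of every stack in which \<open>s\<close> can occur.\<close>

definition pop :: "'a \<Rightarrow> ('a \<Rightarrow> 'a \<Rightarrow> 'a list) \<Rightarrow> 'a \<Rightarrow> 'a \<Rightarrow> 'a list" where
  "pop s F = (\<lambda>a b. if touched s a b then tl (F a b) else F a b)"

text \<open>The action of a generator on families of stacks.\<close>

definition act :: "'a \<Rightarrow> ('a \<Rightarrow> 'a \<Rightarrow> 'a list) \<Rightarrow> 'a \<Rightarrow> 'a \<Rightarrow> 'a list" where
  "act s F = (if descent s F then pop s F else push s F)"

text \<open>The family of stacks of a word, the last letter being put down first. As \<open>act\<close> removes letters too,
it depends only on the group element (\<open>weq_piles\<close>).\<close>

definition piles :: "'a list \<Rightarrow> 'a \<Rightarrow> 'a \<Rightarrow> 'a list" where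
  "piles v = foldr act v (\<lambda>a b. [])"

lemma piles_simps [simp]: "piles [] = (\<lambda>a b. [])" "piles (s # v) = act s (piles v)"
  by (simp_all add: piles_def)

text \<open>Words whose letters are all put down and never removed. These are the words of minimal length
in their class (\<open>reduced_iff\<close>).\<close>

inductive reduced :: "'a list \<Rightarrow> bool" where
  reduced_Nil: "reduced []"
| reduced_Cons: "reduced v \<Longrightarrow> s \<in> S \<Longrightarrow> \<not> descent s (piles v) \<Longrightarrow> reduced (s # v)"

inductive_cases reduced_ConsE: "reduced (s # v)"

lemma reduced_lists: "reduced v \<Longrightarrow> v \<in> lists S"
  by (induction rule: reduced.induct) auto

lemma touched_self: "s \<in> S \<Longrightarrow> touched s s s"
  using commuting_irrefl[of s] by (auto simp: touched_def commuting_def)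

lemma touched_commuting: "commuting s t \<Longrightarrow> touched s a b \<Longrightarrow> \<not> touched t a b"
  using commuting_sym[of s t] commuting_irrefl by (auto simp: touched_def commuting_def)

lemma descent_commuting: assumes "commuting s t" shows "descent s (push t F) = descent s F" "descent s (pop t F) = descent s F"
    "descent s (act t F) = descent s F"
  using touched_commuting[OF assms] by (auto simp: descent_def push_def pop_def act_def)

lemma act_commuting: assumes "commuting s t" shows "act s (act t F) = act t (act s F)"
proof -
  have *: "touched s a b \<Longrightarrow> \<not> touched t a b" for a b using touched_commuting[OF assms] by auto
  show ?thesis
    using descent_commuting[OF assms, of F] descent_commuting[OF commuting_sym[OF assms], of F] *
    by (auto simp: act_def push_def pop_def fun_eq_iff)
qed

lemma descent_push: "descent s (push s F)"
  by (simp add: descent_def push_def)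

lemma pop_push [simp]: "pop s (push s F) = F"
  by (auto simp: pop_def push_def fun_eq_iff)

lemma push_pop: "descent s F \<Longrightarrow> push s (pop s F) = F"
  by (fastforce simp: pop_def push_def fun_eq_iff descent_def)

text \<open>Two distinct non-commuting generators share a stack, and cannot both be on top of it.\<close>

lemma descent_push_commuting: assumes "s \<in> S" "t \<in> S" "s \<noteq> t" "descent s (push t F)" shows "commuting s t"
proof (rule ccontr)
  assume "\<not> commuting s t"
  then have "touched s s t" "touched t s t" using assms by (auto simp: touched_def commuting_def)
  with assms(3,4) show False unfolding descent_def push_def by (metis list.sel(1))
qed

text \<open>The normal form behind all exchange properties: a letter on top of all its stacks can be moved to the
front of the reduced word by commutations, and what remains is reduced.\<close>

lemma descent_split:
  assumes "reduced v" "s \<in> S" "descent s (piles v)"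
  shows "\<exists>a b. v = a @ s # b \<and> (\<forall>x\<in>set a. commuting s x) \<and> reduced (a @ b) \<and>
           piles (a @ b) = pop s (piles v) \<and> \<not> descent s (piles (a @ b))"
  using assms
proof (induction rule: reduced.induct)
  case reduced_Nil
  then show ?case using touched_self[of s] by (auto simp: descent_def)
next
  case (reduced_Cons v t)
  have cons: "piles (t # v) = push t (piles v)" using reduced_Cons by (simp add: act_def)
  show ?case
  proof (cases "s = t")
    case True
    then show ?thesis using reduced_Cons cons by (intro exI[of _ "[]"] exI[of _ v]) simp
  next
    case False
    with reduced_Cons.prems reduced_Cons.hyps cons have c: "commuting s t" using descent_push_commuting by metis
    then have "descent s (piles v)" using reduced_Cons.prems cons descent_commuting by metis
    with reduced_Cons.IH reduced_Cons.prems obtain a b where ab: "v = a @ s # b" "\<forall>x\<in>set a. commuting s x"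
      "reduced (a @ b)" "piles (a @ b) = pop s (piles v)" "\<not> descent s (piles (a @ b))" by blast
    have nd: "\<not> descent t (piles (a @ b))" using ab reduced_Cons.hyps descent_commuting[OF commuting_sym[OF c]] by metis
    have s2: "piles (t # a @ b) = push t (pop s (piles v))" using nd ab by (simp add: act_def)
    also have "\<dots> = pop s (push t (piles v))"
      using touched_commuting[OF c] by (auto simp: push_def pop_def fun_eq_iff)
    finally have "piles (t # a @ b) = pop s (piles (t # v))" using cons by simp
    moreover have "\<not> descent s (piles (t # a @ b))"
      using ab nd descent_commuting[OF c] s2 by metis
    ultimately show ?thesis using ab c nd reduced_Cons.hyps
      by (intro exI[of _ "t # a"] exI[of _ b]) (auto intro: reduced.reduced_Cons)
  qed
qed

lemma weq_move:
  assumes "s \<in> S" "\<forall>x\<in>set a. commuting s x" "a \<in> lists S" "b \<in> lists S"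
  shows "weq (emb (a @ s # b)) (emb (s # a @ b))"
  using assms
proof (induction a)
  case (Cons t a)
  have "weq ([(t, True)] @ emb (a @ s # b)) ([(t, True)] @ emb (s # a @ b))"
    using Cons by (intro pres_eq_append pres_eq.refl) auto
  moreover have "weq ([(t, True), (s, True)] @ emb (a @ b)) ([(s, True), (t, True)] @ emb (a @ b))"
    using Cons commuting_sym[of s t] by (intro pres_eq_append weq_commuting pres_eq.refl) auto
  ultimately show ?case using pres_eq.trans by fastforce
qed (auto intro: pres_eq.refl)

text \<open>Reduction uses the defining relations only, so that the stacks determine the group element.\<close>

lemma reduced_rep:
  assumes "v \<in> lists S" shows "\<exists>v'. reduced v' \<and> piles v' = piles v \<and> weq (emb v) (emb v') \<and> length v' \<le> length v"
  using assms
proof (induction v)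
  case Nil
  then show ?case by (auto intro: reduced_Nil pres_eq.refl)
next
  case (Cons s v)
  then obtain v' where v': "reduced v'" "piles v' = piles v" "weq (emb v) (emb v')" "length v' \<le> length v"
    by auto
  have sS: "s \<in> S" using Cons by simp
  have p: "weq (emb (s # v)) (emb (s # v'))"
    using pres_eq_append[OF pres_eq.refl[of "[(s, True)]" S] v'(3)] sS by simp
  show ?case
  proof (cases "descent s (piles v')")
    case False
    then show ?thesis using v' sS p by (intro exI[of _ "s # v'"]) (auto intro: reduced_Cons)
  next
    case True
    obtain a b where ab: "v' = a @ s # b" "\<forall>x\<in>set a. commuting s x" "reduced (a @ b)"
      "piles (a @ b) = pop s (piles v')" using descent_split[OF v'(1) sS True] by blast
    have l: "a \<in> lists S" "b \<in> lists S" using ab reduced_lists by fastforce+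
    have "weq ([(s, True)] @ emb v') ([(s, True)] @ emb (s # a @ b))"
      unfolding ab(1) using l sS ab by (intro pres_eq_append weq_move pres_eq.refl) auto
    moreover have "weq ([(s, True), (s, True)] @ emb (a @ b)) ([] @ emb (a @ b))"
      using l sS by (intro pres_eq_append weq_square pres_eq.refl) auto
    ultimately have "weq (emb (s # v')) (emb (a @ b))" using pres_eq.trans by fastforce
    with p have "weq (emb (s # v)) (emb (a @ b))" using pres_eq.trans by fast
    then show ?thesis using v' ab True by (intro exI[of _ "a @ b"]) (auto simp: act_def)
  qed
qed

lemma act_act: assumes "v \<in> lists S" "s \<in> S" shows "act s (act s (piles v)) = piles v"
proof -
  obtain v' where v': "reduced v'" "piles v' = piles v" using reduced_rep[OF assms(1)] by blast
  show ?thesis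
  proof (cases "descent s (piles v)")
    case True
    then have "\<not> descent s (pop s (piles v))" using descent_split[OF v'(1) assms(2)] v'(2) by auto
    then show ?thesis using True push_pop by (simp add: act_def)
  next
    case False
    then show ?thesis by (simp add: act_def descent_push)
  qed
qed

lemma piles_append: "piles (u @ v) = foldr act u (piles v)"
  by (simp add: piles_def)

lemma weq_piles: "weq u v \<Longrightarrow> piles (map fst u) = piles (map fst v)"
proof (induction rule: pres_eq.induct)
  case (cancel u v s b)
  then show ?case using act_act[of "map fst v" s] fst_words[of v S] by (simp add: piles_append)
next
  case (relation u v x y)
  have "foldr act (map fst x) (piles (map fst v)) = foldr act (map fst y) (piles (map fst v))"
    using relation(3) unfolding racg_relations_def
  proof (elim UnE CollectE exE conjE)
    fix s assume "(x, y) = ([(s, True), (s, True)], [])" "s \<in> S"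
    then show ?thesis using act_act[of "map fst v" s] fst_words[of v S] relation by simp
  next
    fix s t assume "(x, y) = ([(s, True), (t, True)], [(t, True), (s, True)])"
      "s \<in> S" "t \<in> S" "m s t = 2"
    then show ?thesis using act_commuting[of s t] by (simp add: commuting_def)
  qed
  then show ?case by (simp add: piles_append)
qed auto

text \<open>The number of letters in a family of stacks: a letter \<open>s\<close> is counted in the stack at \<open>(s, s)\<close>,
where no other letter occurs.\<close>

definition piles_length :: "('a \<Rightarrow> 'a \<Rightarrow> 'a list) \<Rightarrow> nat" where
  "piles_length F = (\<Sum>s\<in>S. length (F s s))"

lemma piles_length_push: assumes "s \<in> S" shows "piles_length (push s F) = Suc (piles_length F)"
proof -
  have "length (push s F t t) = length (F t t) + (if t = s then 1 else 0)" if "t \<in> S" for t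
    using touched_self[OF assms] by (auto simp: push_def touched_def)
  then have "piles_length (push s F) = (\<Sum>t\<in>S. length (F t t) + (if t = s then 1 else 0))"
    unfolding piles_length_def by (intro sum.cong) auto
  also have "\<dots> = Suc (piles_length F)" using finS assms by (simp add: sum.distrib piles_length_def)
  finally show ?thesis .
qed

lemma piles_length_reduced: "reduced v \<Longrightarrow> piles_length (piles v) = length v"
  by (induction rule: reduced.induct) (simp_all add: act_def piles_length_push, simp add: piles_length_def)

lemma piles_length_act: "s \<in> S \<Longrightarrow> piles_length (act s F) = (if descent s F then piles_length F - 1 else Suc (piles_length F))"
  using piles_length_push[of s F] piles_length_push[of s "pop s F"] push_pop[of s F] by (auto simp: act_def)

lemma piles_length_le: "v \<in> lists S \<Longrightarrow> piles_length (piles v) \<le> length v"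
proof (induction v)
  case Nil then show ?case by (simp add: piles_length_def)
next
  case (Cons s v) then show ?case by (auto simp: piles_length_act)
qed

lemma reduced_iff_piles_length: assumes "v \<in> lists S" shows "reduced v \<longleftrightarrow> piles_length (piles v) = length v"
proof
  show "piles_length (piles v) = length v \<Longrightarrow> reduced v"
    using assms
  proof (induction v)
    case (Cons s v)
    have "piles_length (piles v) \<le> length v" using Cons piles_length_le by auto
    then show ?case using Cons by (auto simp: piles_length_act intro: reduced_Cons split: if_splits)
  qed (rule reduced_Nil)
qed (rule piles_length_reduced)

lemma cls_piles: "u \<in> lists S \<Longrightarrow> v \<in> lists S \<Longrightarrow> cls u = cls v \<Longrightarrow> piles u = piles v"
  using weq_piles[of "emb u" "emb v"] cls_eq_iff by simp

lemma word_length_cls: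
  assumes "v \<in> lists S" shows "word_length (cls v) = piles_length (piles v)"
proof -
  obtain v' where v': "reduced v'" "piles v' = piles v" "weq (emb v) (emb v')" using reduced_rep[OF assms] by blast
  show ?thesis unfolding word_length_def
  proof (rule Least_equality)
    show "\<exists>u\<in>cls v. length u = piles_length (piles v)"
      using v' piles_length_reduced[OF v'(1)] by (intro bexI[of _ "emb v'"]) (auto simp: cls_def word_class_def)
    fix n assume "\<exists>u\<in>cls v. length u = n"
    then obtain u where u: "weq (emb v) u" "length u = n" by (auto simp: cls_def word_class_def)
    then have "piles (map fst u) = piles v" using weq_piles by fastforce
    moreover have "map fst u \<in> lists S" using u pres_eq_words fst_words by blast
    ultimately show "piles_length (piles v) \<le> n" using piles_length_le u by fastforce
  qed
qed

lemma carrier_reduced: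
  assumes "w \<in> carrier (racg S m)" obtains v where "reduced v" "w = cls v"
  proof -
  obtain u where u: "u \<in> lists S" "w = cls u" using assms by (auto simp: carrier_racg)
  obtain v where v: "reduced v" "weq (emb u) (emb v)" using reduced_rep[OF u(1)] by blast
  have "cls u = cls v" using v cls_eq_iff[OF reduced_lists[OF v(1)]] by simp
  then show thesis using that v u by blast
qed

lemma word_length_reduced: "reduced v \<Longrightarrow> word_length (cls v) = length v"
  using word_length_cls reduced_lists piles_length_reduced by simp

lemma word_length_le: "v \<in> lists S \<Longrightarrow> word_length (cls v) \<le> length v"
  using word_length_cls piles_length_le by simp

lemma reduced_iff: "v \<in> lists S \<Longrightarrow> reduced v \<longleftrightarrow> word_length (cls v) = length v"
  using word_length_cls reduced_iff_piles_length by simp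

section \<open>Left and right multiplication by generators\<close>

text \<open>Left multiplication by a generator.\<close>

definition lmult :: "'a \<Rightarrow> 'a word set \<Rightarrow> 'a word set" where
  "lmult s w = racg_gen S m s \<otimes>\<^bsub>racg S m\<^esub> w"

text \<open>Left multiplication by \<open>s\<close> lengthens \<open>w\<close>.\<close>

definition up :: "'a \<Rightarrow> 'a word set \<Rightarrow> bool" where
  "up s w \<longleftrightarrow> word_length w < word_length (lmult s w)"

lemma lmult_cls: "s \<in> S \<Longrightarrow> v \<in> lists S \<Longrightarrow> lmult s (cls v) = cls (s # v)"
  using racg_mult[of "[s]" v] by (simp add: lmult_def racg_gen_cls)

lemma lmult_carrier: "s \<in> S \<Longrightarrow> w \<in> carrier (racg S m) \<Longrightarrow> lmult s w \<in> carrier (racg S m)"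
  by (auto simp: lmult_cls elim!: carrier_cases)

lemma up_cls: "s \<in> S \<Longrightarrow> v \<in> lists S \<Longrightarrow> up s (cls v) \<longleftrightarrow> \<not> descent s (piles v)"
  by (auto simp: up_def lmult_cls word_length_cls piles_length_act)

lemma piles_length_pos: "s \<in> S \<Longrightarrow> descent s F \<Longrightarrow> piles_length F > 0"
  using piles_length_push[of s "pop s F"] push_pop[of s F] by simp

lemma not_up: "s \<in> S \<Longrightarrow> w \<in> carrier (racg S m) \<Longrightarrow> \<not> up s w \<longleftrightarrow> word_length (lmult s w) < word_length w"
  using piles_length_pos by (auto simp: up_cls lmult_cls word_length_cls piles_length_act elim!: carrier_cases)

lemma lmult_lmult: assumes "s \<in> S" "w \<in> carrier (racg S m)" shows "lmult s (lmult s w) = w"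
proof -
  obtain v where v: "v \<in> lists S" "w = cls v" using assms by (auto simp: carrier_racg)
  have "weq ([(s, True), (s, True)] @ emb v) ([] @ emb v)"
    using assms v by (intro pres_eq_append weq_square pres_eq.refl) auto
  then show ?thesis using assms v by (simp add: lmult_cls cls_eq_iff)
qed

lemma up_lmult: "s \<in> S \<Longrightarrow> w \<in> carrier (racg S m) \<Longrightarrow> up s (lmult s w) \<longleftrightarrow> \<not> up s w"
  using not_up[of s w] lmult_lmult[of s w] by (simp add: up_def)

lemma lmult_commuting: assumes "commuting s t" "w \<in> carrier (racg S m)" shows "lmult s (lmult t w) = lmult t (lmult s w)"
proof -
  obtain v where v: "v \<in> lists S" "w = cls v" using assms by (auto simp: carrier_racg)
  have "weq ([(s, True), (t, True)] @ emb v) ([(t, True), (s, True)] @ emb v)"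
    using assms v by (intro pres_eq_append weq_commuting pres_eq.refl) auto
  then show ?thesis using assms v by (auto simp: lmult_cls cls_eq_iff commuting_def)
qed

lemma up_commuting: assumes "commuting s t" "w \<in> carrier (racg S m)" shows "up s (lmult t w) = up s w"
proof -
  obtain v where v: "v \<in> lists S" "w = cls v" using assms by (auto simp: carrier_racg)
  then show ?thesis using assms descent_commuting[OF assms(1)] by (auto simp: lmult_cls up_cls commuting_def)
qed

text \<open>Inversion. The generators are involutions, so it reverses words; on classes of words it is therefore
the image under \<open>rev\<close>, which preserves word length by its very form.\<close>

definition winv :: "'a word set \<Rightarrow> 'a word set" where
  "winv w = rev ` w"

lemma winv_winv [simp]: "winv (winv w) = w"
  by (auto simp: winv_def image_image)

lemma word_length_winv [simp]: "word_length (winv w) = word_length w"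
  by (simp add: word_length_def winv_def)

lemma weq_rev: "weq u v \<Longrightarrow> weq (rev u) (rev v)"
proof (induction rule: pres_eq.induct)
  case (cancel u v s b)
  then show ?case using pres_eq.cancel[of "rev v" S "rev u" s "racg_relations S m" "\<not> b"] by simp
next
  case (relation u v x y)
  have "(rev x, rev y) \<in> racg_relations S m"
    using relation(3) m_sym by (fastforce simp: racg_relations_def)
  then show ?case using relation pres_eq.relation[of "rev v" S "rev u" "rev x" "rev y"] by simp
qed (auto intro: pres_eq.intros)

lemma winv_cls: "winv (cls v) = cls (rev v)"
proof -
  have "weq (emb v) u \<Longrightarrow> weq (emb (rev v)) (rev u)" for u using weq_rev by force
  moreover have "weq (emb (rev v)) u \<Longrightarrow> u \<in> rev ` {u. weq (emb v) u}" for u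
    using weq_rev[of "emb (rev v)" u] by (intro image_eqI[of _ _ "rev u"]) auto
  ultimately show ?thesis by (auto simp: winv_def cls_def word_class_def)
qed

lemma winv_carrier: "w \<in> carrier (racg S m) \<Longrightarrow> winv w \<in> carrier (racg S m)"
  by (auto simp: winv_cls elim!: carrier_cases)

text \<open>Right multiplication by a generator, as the mirror image of left multiplication.\<close>

definition rmult :: "'a \<Rightarrow> 'a word set \<Rightarrow> 'a word set" where
  "rmult t w = winv (lmult t (winv w))"

lemma rmult_carrier: "s \<in> S \<Longrightarrow> w \<in> carrier (racg S m) \<Longrightarrow> rmult s w \<in> carrier (racg S m)"
  by (simp add: rmult_def lmult_carrier winv_carrier)

lemma rmult_rmult: "s \<in> S \<Longrightarrow> w \<in> carrier (racg S m) \<Longrightarrow> rmult s (rmult s w) = w"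
  by (simp add: rmult_def lmult_lmult winv_carrier)

lemma rmult_cls: "s \<in> S \<Longrightarrow> v \<in> lists S \<Longrightarrow> rmult s (cls v) = cls (v @ [s])"
  by (simp add: rmult_def winv_cls lmult_cls in_lists_conv_set)

lemma lmult_rmult: "s \<in> S \<Longrightarrow> t \<in> S \<Longrightarrow> w \<in> carrier (racg S m) \<Longrightarrow> lmult s (rmult t w) = rmult t (lmult s w)"
  by (auto simp: rmult_cls lmult_cls elim!: carrier_cases)

lemma winv_lmult: "winv (lmult s w) = rmult s (winv w)"
  by (simp add: rmult_def)

lemma reduced_rev: assumes "reduced v" shows "reduced (rev v)"
  using assms reduced_lists[OF assms] reduced_iff[of "rev v"] reduced_iff[of v]
    word_length_winv[of "cls v"] by (simp add: winv_cls in_lists_conv_set)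

lemma descent_commutingI:
  assumes "s \<in> S" "b \<in> lists S" "\<forall>x\<in>set a. commuting s x" "reduced (a @ s # b)"
  shows "descent s (piles (a @ s # b))"
  using assms(3,4)
proof (induction a)
  case Nil
  then show ?case by (auto simp: act_def descent_push elim!: reduced_ConsE)
next
  case (Cons t a)
  then show ?case using descent_commuting(3)[of s t] by (auto elim!: reduced_ConsE)
qed

lemma reduced_tl: "reduced (u @ v) \<Longrightarrow> reduced v"
  by (induction u) (auto elim: reduced_ConsE)

lemma descent_snoc:
  assumes "reduced (v @ [t])" "s \<in> S" "descent s (piles v)" shows "descent s (piles (v @ [t]))"
proof -
  have r: "reduced v" using reduced_rev[OF assms(1)] reduced_rev by (force elim: reduced_ConsE)
  obtain a b where ab: "v = a @ s # b" "\<forall>x\<in>set a. commuting s x" using descent_split r assms by blast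
  show ?thesis using descent_commutingI[of s "b @ [t]" a] ab assms reduced_lists[OF assms(1)] by auto
qed

text \<open>If the last letter of a reduced word creates a new descent \<open>s\<close>, then in the form \<open>a @ s # b\<close> the tail
\<open>b\<close> is empty, as otherwise \<open>s\<close> would be a descent already without the last letter.\<close>

lemma descent_snocD:
  assumes "reduced (v @ [t])" "s \<in> S" "descent s (piles (v @ [t]))" "\<not> descent s (piles v)"
  shows "s = t" "lmult s (cls v) = cls (v @ [t])"
proof -
  have r: "reduced v" using reduced_rev[OF assms(1)] reduced_rev by (force elim: reduced_ConsE)
  obtain a b where ab: "v @ [t] = a @ s # b" "\<forall>x\<in>set a. commuting s x" 
    using descent_split[OF assms(1-3)] by blast
  have "b = []"
  proof (rule ccontr)
    assume "b \<noteq> []"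
    then obtain b' where "b = b' @ [t]" "v = a @ s # b'"
      using ab(1) by (cases b rule: rev_cases) auto
    then show False using descent_commutingI[of s b' a] ab assms r reduced_lists[OF r] by auto
  qed
  then have e: "v = a" "s = t" using ab by auto
  show "s = t" by fact
  have "weq (emb (a @ s # [])) (emb (s # a @ []))" 
    using ab e reduced_lists[OF r] assms by (intro weq_move) auto
  then show "lmult s (cls v) = cls (v @ [t])"
    using e reduced_lists[OF r] assms lmult_cls[of s v] cls_eq_iff[of "s # v" "v @ [t]"] by simp
qed

text \<open>The exchange property: right multiplication by \<open>t\<close> changes whether \<open>s\<close> lengthens only in the
case \<open>sw = wt\<close>.\<close>

lemma up_rmult:
  assumes "s \<in> S" "t \<in> S" "w \<in> carrier (racg S m)" "up s (rmult t w) \<noteq> up s w"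
  shows "s = t" "lmult s w = rmult t w"
proof -
  have main: "s = t \<and> lmult s w = rmult t w" 
    if w: "w \<in> carrier (racg S m)" "up s (rmult t w) \<noteq> up s w" "word_length w < word_length (rmult t w)" for w
  proof -
    obtain v where v: "reduced v" "w = cls v" using w(1) by (rule carrier_reduced)
    have l: "v \<in> lists S" "v @ [t] \<in> lists S" using reduced_lists[OF v(1)] assms by auto
    have "word_length (cls (v @ [t])) = length (v @ [t])"
      using w v word_length_reduced[OF v(1)] word_length_le[OF l(2)] assms l by (simp add: rmult_cls)
    then have r: "reduced (v @ [t])" using reduced_iff l by blast
    have *: "descent s (piles (v @ [t])) \<noteq> descent s (piles v)"
      using w v up_cls[of s v] up_cls[of s "v @ [t]"] assms l by (simp add: rmult_cls)
    then have "descent s (piles (v @ [t]))" "\<not> descent s (piles v)" using descent_snoc[OF r assms(1)] by blast+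
    then show ?thesis using descent_snocD[OF r assms(1)] v assms l by (simp add: rmult_cls)
  qed
  have rw: "rmult t w \<in> carrier (racg S m)" using assms rmult_carrier by blast
  have piles_length: "word_length (rmult t w) = word_length (lmult t (winv w))" by (simp add: rmult_def)
  have "s = t \<and> lmult s w = rmult t w"
  proof (cases "up t (winv w)")
    case True
    then have "word_length w < word_length (rmult t w)" using piles_length by (simp add: up_def)
    then show ?thesis by (rule main[OF assms(3,4)])
  next
    case False
    then have "word_length (rmult t w) < word_length w"
      using not_up[of t "winv w"] assms winv_carrier piles_length by simp
    then have "s = t \<and> lmult s (rmult t w) = rmult t (rmult t w)"
      using main[OF rw] assms(4) rmult_rmult[OF assms(2,3)] by auto
    then show ?thesis using lmult_lmult[of s "rmult t w"] rmult_rmult[of t w] assms rw by metis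
  qed
  then show "s = t" "lmult s w = rmult t w" by auto
qed

text \<open>The mirror image of \<open>up_rmult\<close>: \<open>up t (winv w)\<close> says that right multiplication by \<open>t\<close> lengthens \<open>w\<close>.\<close>

lemma up_winv_lmult:
  assumes "s \<in> S" "t \<in> S" "w \<in> carrier (racg S m)" "up t (winv (lmult s w)) \<noteq> up t (winv w)"
  shows "s = t" "lmult s w = rmult t w"
proof -
  have *: "t = s" "lmult t (winv w) = rmult s (winv w)"
    using up_rmult[of t s "winv w"] assms winv_carrier by (simp_all add: winv_lmult)
  then show "s = t" "lmult s w = rmult t w" by (simp_all add: rmult_def)
qed

lemma up_eq_winv: "lmult s w = rmult s w \<Longrightarrow> up s w = up s (winv w)"
  using word_length_winv[of "lmult s (winv w)"] by (simp add: up_def rmult_def)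

end

section \<open>Bounded operators on square-summable functions\<close>

lemma ell2_summable: "f \<in> ell2 I \<Longrightarrow> (\<lambda>i. (cmod (f i))\<^sup>2) summable_on I"
  by (simp add: ell2_def)

lemma ell2_outside: "f \<in> ell2 I \<Longrightarrow> i \<notin> I \<Longrightarrow> f i = 0"
  by (simp add: ell2_def)

lemma ell2_eqI:
  assumes "f \<in> ell2 I" "g \<in> ell2 I" "\<And>i. i \<in> I \<Longrightarrow> f i = g i" shows "f = g"
proof
  fix i show "f i = g i" using assms by (cases "i \<in> I") (simp_all add: ell2_outside)
qed

lemma ell2_norm_nonneg [simp]: "0 \<le> ell2_norm I f"
  by (simp add: ell2_norm_def infsum_nonneg)

lemma L2_set_le_ell2_norm:
  assumes "f \<in> ell2 I" "finite F" "F \<subseteq> I"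
  shows "L2_set (\<lambda>i. cmod (f i)) F \<le> ell2_norm I f"
  unfolding L2_set_def ell2_norm_def
  by (intro real_sqrt_le_mono finite_sum_le_infsum ell2_summable assms) auto

text \<open>Membership and norm bounds are checked on finite sets, which reduces norm estimates to those for
\<open>L2_set\<close>.\<close>

lemma ell2_boundedI:
  assumes "\<And>i. i \<notin> I \<Longrightarrow> f i = 0"
    and "\<And>F. finite F \<Longrightarrow> F \<subseteq> I \<Longrightarrow> L2_set (\<lambda>i. cmod (f i)) F \<le> B"
  shows "f \<in> ell2 I" "ell2_norm I f \<le> B"
proof -
  have B: "0 \<le> B" using assms(2)[of "{}"] by simp
  have s: "(\<Sum>i\<in>F. (cmod (f i))\<^sup>2) \<le> B\<^sup>2" if "finite F" "F \<subseteq> I" for F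
    using assms(2)[OF that] unfolding L2_set_def by (rule sqrt_le_D)
  then have "(\<lambda>i. (cmod (f i))\<^sup>2) summable_on I"
    by (intro nonneg_bdd_above_summable_on bdd_aboveI2[where M = "B\<^sup>2"]) auto
  then show "f \<in> ell2 I" using assms by (simp add: ell2_def)
  have "(\<Sum>\<^sub>\<infinity>i\<in>I. (cmod (f i))\<^sup>2) \<le> B\<^sup>2"
    using \<open>_ summable_on I\<close> s by (rule infsum_le_finite_sums)
  then show "ell2_norm I f \<le> B" unfolding ell2_norm_def using B by (intro real_le_lsqrt) auto
qed

lemma ell2_zero: "(\<lambda>i. 0) \<in> ell2 I"
  by (simp add: ell2_def)

lemma ell2_norm_zero [simp]: "ell2_norm I (\<lambda>i. 0) = 0"
  by (simp add: ell2_norm_def)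

lemma ell2_add:
  assumes "f \<in> ell2 I" "g \<in> ell2 I"
  shows "(\<lambda>i. f i + g i) \<in> ell2 I" "ell2_norm I (\<lambda>i. f i + g i) \<le> ell2_norm I f + ell2_norm I g"
proof -
  have "L2_set (\<lambda>i. cmod (f i + g i)) F \<le> ell2_norm I f + ell2_norm I g"
    if "finite F" "F \<subseteq> I" for F
  proof -
    have "L2_set (\<lambda>i. cmod (f i + g i)) F \<le> L2_set (\<lambda>i. cmod (f i) + cmod (g i)) F"
      by (intro L2_set_mono norm_triangle_ineq) auto
    also have "\<dots> \<le> L2_set (\<lambda>i. cmod (f i)) F + L2_set (\<lambda>i. cmod (g i)) F"
      by (rule L2_set_triangle_ineq)
    finally show ?thesis
      using L2_set_le_ell2_norm[OF assms(1) that] L2_set_le_ell2_norm[OF assms(2) that] by linarith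
  qed
  from ell2_boundedI[OF _ this] assms show
    "(\<lambda>i. f i + g i) \<in> ell2 I" "ell2_norm I (\<lambda>i. f i + g i) \<le> ell2_norm I f + ell2_norm I g"
    by (simp_all add: ell2_outside)
qed

lemma ell2_scale_le:
  assumes "f \<in> ell2 I"
  shows "(\<lambda>i. c * f i) \<in> ell2 I" "ell2_norm I (\<lambda>i. c * f i) \<le> cmod c * ell2_norm I f"
proof -
  have "L2_set (\<lambda>i. cmod (c * f i)) F \<le> cmod c * ell2_norm I f" if "finite F" "F \<subseteq> I" for F
    using L2_set_le_ell2_norm[OF assms that]
    by (simp add: norm_mult L2_set_right_distrib[symmetric] mult_left_mono)
  from ell2_boundedI[OF _ this] assms show
    "(\<lambda>i. c * f i) \<in> ell2 I" "ell2_norm I (\<lambda>i. c * f i) \<le> cmod c * ell2_norm I f"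
    by (simp_all add: ell2_outside)
qed

lemma ell2_norm_scale:
  assumes "f \<in> ell2 I" shows "ell2_norm I (\<lambda>i. c * f i) = cmod c * ell2_norm I f"
proof (cases "c = 0")
  case False
  have "ell2_norm I (\<lambda>i. inverse c * (c * f i)) \<le> cmod (inverse c) * ell2_norm I (\<lambda>i. c * f i)"
    by (intro ell2_scale_le assms)
  moreover have "(\<lambda>i. inverse c * (c * f i)) = f" using False by (simp add: mult.assoc[symmetric])
  ultimately have "cmod c * ell2_norm I f \<le> ell2_norm I (\<lambda>i. c * f i)"
    using False by (simp add: norm_inverse norm_divide field_simps)
  then show ?thesis using ell2_scale_le(2)[OF assms, of c] by simp
qed simp

lemma ell2_coord_le: "f \<in> ell2 I \<Longrightarrow> cmod (f i) \<le> ell2_norm I f"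
  using L2_set_le_ell2_norm[of f I "{i}"] by (cases "i \<in> I") (simp_all add: ell2_outside L2_set_def)

lemma ell2_inner_summable:
  assumes "f \<in> ell2 I" "g \<in> ell2 I"
  shows "(\<lambda>i. cmod (f i * cnj (g i))) summable_on I"
    and "cmod (ell2_inner I f g) \<le> ell2_norm I f * ell2_norm I g"
proof -
  have s: "(\<Sum>i\<in>F. cmod (f i * cnj (g i))) \<le> ell2_norm I f * ell2_norm I g"
    if "finite F" "F \<subseteq> I" for F
  proof -
    have "(\<Sum>i\<in>F. cmod (f i * cnj (g i))) \<le> L2_set (\<lambda>i. cmod (f i)) F * L2_set (\<lambda>i. cmod (g i)) F"
      using L2_set_mult_ineq[of "\<lambda>i. cmod (f i)" "\<lambda>i. cmod (g i)" F] by (simp add: norm_mult)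
    also have "\<dots> \<le> ell2_norm I f * ell2_norm I g"
      using L2_set_le_ell2_norm assms that by (intro mult_mono) auto
    finally show ?thesis .
  qed
  show a: "(\<lambda>i. cmod (f i * cnj (g i))) summable_on I"
    by (intro nonneg_bdd_above_summable_on bdd_aboveI2[where M = "ell2_norm I f * ell2_norm I g"])
      (use s in auto)
  have "cmod (ell2_inner I f g) \<le> (\<Sum>\<^sub>\<infinity>i\<in>I. cmod (f i * cnj (g i)))"
    unfolding ell2_inner_def using a by (rule norm_infsum_bound)
  also have "\<dots> \<le> ell2_norm I f * ell2_norm I g"
    using a s by (rule infsum_le_finite_sums)
  finally show "cmod (ell2_inner I f g) \<le> ell2_norm I f * ell2_norm I g" .
qed

lemma ell2_inner_add_left:
  "f \<in> ell2 I \<Longrightarrow> f' \<in> ell2 I \<Longrightarrow> g \<in> ell2 I \<Longrightarrow>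
    ell2_inner I (\<lambda>i. f i + f' i) g = ell2_inner I f g + ell2_inner I f' g"
  unfolding ell2_inner_def
  by (simp add: distrib_right infsum_add abs_summable_summable ell2_inner_summable)

lemma ell2_inner_scale_left: "ell2_inner I (\<lambda>i. c * f i) g = c * ell2_inner I f g"
  by (simp add: ell2_inner_def mult.assoc infsum_cmult_right')

lemma ell2_inner_cnj: "cnj (ell2_inner I f g) = ell2_inner I g f"
  unfolding ell2_inner_def by (simp add: infsum_cnj[symmetric] mult.commute del: infsum_cnj)

lemma ell2_inner_add_right:
  "f \<in> ell2 I \<Longrightarrow> f' \<in> ell2 I \<Longrightarrow> g \<in> ell2 I \<Longrightarrow>
    ell2_inner I g (\<lambda>i. f i + f' i) = ell2_inner I g f + ell2_inner I g f'"
  unfolding ell2_inner_cnj[of I _ g, symmetric] by (simp add: ell2_inner_add_left)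

lemma ell2_inner_scale_right: "ell2_inner I g (\<lambda>i. c * f i) = cnj c * ell2_inner I g f"
  unfolding ell2_inner_cnj[of I _ g, symmetric] by (simp add: ell2_inner_scale_left)

lemma delta_ell2: "i \<in> I \<Longrightarrow> delta i \<in> ell2 I"
proof -
  assume i: "i \<in> I"
  have "(\<lambda>j. (cmod (delta i j))\<^sup>2) summable_on I \<longleftrightarrow> (\<lambda>j. (cmod (delta i j))\<^sup>2) summable_on {i}"
    using i by (intro summable_on_cong_neutral) (auto simp: delta_def)
  then show ?thesis using i by (auto simp: ell2_def delta_def)
qed

lemma ell2_inner_delta: "i \<in> I \<Longrightarrow> ell2_inner I f (delta i) = f i"
proof -
  assume i: "i \<in> I"
  have "ell2_inner I f (delta i) = (\<Sum>\<^sub>\<infinity>j\<in>{i}. f j * cnj (delta i j))"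
    unfolding ell2_inner_def using i by (intro infsum_cong_neutral) (auto simp: delta_def)
  then show ?thesis by (simp add: delta_def)
qed

lemma bounded_opD:
  assumes "bounded_op I T"
  shows "f \<in> ell2 I \<Longrightarrow> T f \<in> ell2 I" "f \<notin> ell2 I \<Longrightarrow> T f = (\<lambda>i. 0)"
    "f \<in> ell2 I \<Longrightarrow> g \<in> ell2 I \<Longrightarrow> T (\<lambda>i. f i + g i) = (\<lambda>i. T f i + T g i)"
    "f \<in> ell2 I \<Longrightarrow> T (\<lambda>i. c * f i) = (\<lambda>i. c * T f i)"
  using assms unfolding bounded_op_def by blast+

lemma bounded_op_closed [simp]: "bounded_op I T \<Longrightarrow> T f \<in> ell2 I"
  using bounded_opD(1,2)[of I T f] ell2_zero by (cases "f \<in> ell2 I") auto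

lemma bounded_op_zero: "bounded_op I T \<Longrightarrow> T (\<lambda>i. 0) = (\<lambda>i. 0)"
  using bounded_opD(4)[of I T "\<lambda>i. 0" 0] ell2_zero[of I] by simp

lemma bounded_op_bound:
  assumes "bounded_op I T"
  obtains K where "K \<ge> 0" "\<And>f. f \<in> ell2 I \<Longrightarrow> ell2_norm I (T f) \<le> K * ell2_norm I f"
proof -
  obtain K where K: "\<And>f. f \<in> ell2 I \<Longrightarrow> ell2_norm I (T f) \<le> K * ell2_norm I f"
    using assms unfolding bounded_op_def by blast
  have "ell2_norm I (T f) \<le> \<bar>K\<bar> * ell2_norm I f" if "f \<in> ell2 I" for f
    using K[OF that] mult_right_mono[OF abs_ge_self[of K] ell2_norm_nonneg[of I f]] by linarith
  then show thesis by (intro that[of "\<bar>K\<bar>"]) auto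
qed

lemma bounded_opI:
  assumes "\<And>f. f \<in> ell2 I \<Longrightarrow> T f \<in> ell2 I" "\<And>f. f \<notin> ell2 I \<Longrightarrow> T f = (\<lambda>i. 0)"
    "\<And>f g. f \<in> ell2 I \<Longrightarrow> g \<in> ell2 I \<Longrightarrow> T (\<lambda>i. f i + g i) = (\<lambda>i. T f i + T g i)"
    "\<And>c f. f \<in> ell2 I \<Longrightarrow> T (\<lambda>i. c * f i) = (\<lambda>i. c * T f i)"
    "\<And>f. f \<in> ell2 I \<Longrightarrow> ell2_norm I (T f) \<le> K * ell2_norm I f"
  shows "bounded_op I T"
  using assms unfolding bounded_op_def by blast

lemma ell2_inner_eqI:
  assumes "f \<in> ell2 I" "g \<in> ell2 I" "\<And>h. h \<in> ell2 I \<Longrightarrow> ell2_inner I h f = ell2_inner I h g"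
  shows "f = g"
proof
  fix i show "f i = g i"
  proof (cases "i \<in> I")
    case True
    then have "ell2_inner I f (delta i) = ell2_inner I g (delta i)"
      using assms(3)[OF delta_ell2[OF True]] ell2_inner_cnj[of I "delta i", symmetric] by simp
    then show ?thesis using True by (simp add: ell2_inner_delta)
  qed (simp add: ell2_outside[OF assms(1)] ell2_outside[OF assms(2)])
qed

text \<open>\<open>U\<close> is an adjoint of \<open>T\<close>; boundedness of \<open>U\<close> is not included.\<close>

definition is_adjoint :: "'i set \<Rightarrow> 'i operator \<Rightarrow> 'i operator \<Rightarrow> bool" where
  "is_adjoint I T U \<longleftrightarrow>
     (\<forall>f\<in>ell2 I. \<forall>g\<in>ell2 I. ell2_inner I (T f) g = ell2_inner I f (U g))"

lemma is_adjointD: "is_adjoint I T U \<Longrightarrow> f \<in> ell2 I \<Longrightarrow> g \<in> ell2 I \<Longrightarrow>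
    ell2_inner I (T f) g = ell2_inner I f (U g)"
  by (simp add: is_adjoint_def)

lemma op_adjoint_eqI:
  assumes "bounded_op I U" "is_adjoint I T U" shows "op_adjoint I T = U"
  unfolding op_adjoint_def
proof (rule the_equality)
  show "bounded_op I U \<and> (\<forall>f\<in>ell2 I. \<forall>g\<in>ell2 I. ell2_inner I (T f) g = ell2_inner I f (U g))"
    using assms by (simp add: is_adjoint_def)
  fix V assume V: "bounded_op I V \<and> (\<forall>f\<in>ell2 I. \<forall>g\<in>ell2 I. ell2_inner I (T f) g = ell2_inner I f (V g))"
  show "V = U"
  proof
    fix g show "V g = U g"
    proof (cases "g \<in> ell2 I")
      case True
      then show ?thesis using V assms is_adjointD[OF assms(2)]
        by (intro ell2_inner_eqI[of _ I]) auto
    next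
      case False
      then show ?thesis using V bounded_opD(2)[OF assms(1)] bounded_opD(2)[of I V] by simp
    qed
  qed
qed

text \<open>Restriction of a vector to a set of coordinates.\<close>

definition trunc :: "'i set \<Rightarrow> ('i \<Rightarrow> complex) \<Rightarrow> 'i \<Rightarrow> complex" where
  "trunc F f = (\<lambda>i. if i \<in> F then f i else 0)"

lemma trunc_ell2:
  assumes "finite F" "F \<subseteq> I" shows "trunc F f \<in> ell2 I"
proof -
  have "(\<lambda>j. (cmod (trunc F f j))\<^sup>2) summable_on I \<longleftrightarrow> (\<lambda>j. (cmod (trunc F f j))\<^sup>2) summable_on F"
    using assms by (intro summable_on_cong_neutral) (auto simp: trunc_def)
  then show ?thesis using assms by (auto simp: ell2_def trunc_def)
qed

lemma ell2_norm_trunc: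
  assumes "finite F" "F \<subseteq> I" shows "ell2_norm I (trunc F f) = L2_set (\<lambda>i. cmod (f i)) F"
proof -
  have "(\<Sum>\<^sub>\<infinity>i\<in>I. (cmod (trunc F f i))\<^sup>2) = (\<Sum>\<^sub>\<infinity>i\<in>F. (cmod (f i))\<^sup>2)"
    using assms by (intro infsum_cong_neutral) (auto simp: trunc_def)
  then show ?thesis using assms by (simp add: ell2_norm_def L2_set_def)
qed

lemma bounded_op_trunc:
  assumes T: "bounded_op I T" and "finite F" "F \<subseteq> I"
  shows "T (trunc F f) = (\<lambda>i. \<Sum>j\<in>F. f j * T (delta j) i)"
  using assms(2,3)
proof (induction F)
  case empty
  then show ?case using bounded_op_zero[OF T] by (simp add: trunc_def)
next
  case (insert j F)
  have "trunc (insert j F) f = (\<lambda>i. f j * delta j i + trunc F f i)"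
    using insert by (auto simp: trunc_def delta_def)
  moreover have "T (\<lambda>i. f j * delta j i + trunc F f i) = (\<lambda>i. f j * T (delta j) i + T (trunc F f) i)"
    using insert T delta_ell2[of j I] trunc_ell2[of F I f]
    by (simp add: bounded_opD(3)[OF T] bounded_opD(4)[OF T] ell2_scale_le)
  ultimately show ?case using insert by simp
qed

lemma trunc_approx:
  assumes "f \<in> ell2 I" "\<epsilon> > 0"
  obtains F0 where "finite F0" "F0 \<subseteq> I"
    "\<And>F. finite F \<Longrightarrow> F0 \<subseteq> F \<Longrightarrow> F \<subseteq> I \<Longrightarrow> ell2_norm I (\<lambda>i. f i - trunc F f i) \<le> \<epsilon>"
proof -
  let ?h = "\<lambda>i. (cmod (f i))\<^sup>2"
  have "(?h has_sum infsum ?h I) I" using ell2_summable[OF assms(1)] by (rule has_sum_infsum)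
  then have "\<forall>\<^sub>F F in finite_subsets_at_top I. dist (sum ?h F) (infsum ?h I) < \<epsilon>\<^sup>2"
    unfolding has_sum_def using assms(2) by (intro tendstoD) auto
  then obtain F0 where F0: "finite F0" "F0 \<subseteq> I"
    "\<forall>F. finite F \<and> F0 \<subseteq> F \<and> F \<subseteq> I \<longrightarrow> dist (sum ?h F) (infsum ?h I) < \<epsilon>\<^sup>2"
    unfolding eventually_finite_subsets_at_top by (elim exE conjE) (rule that)
  have "ell2_norm I (\<lambda>i. f i - trunc F f i) \<le> \<epsilon>" if F: "finite F" "F0 \<subseteq> F" "F \<subseteq> I" for F
  proof (rule ell2_boundedI(2))
    show "i \<notin> I \<Longrightarrow> f i - trunc F f i = 0" for i
      using assms F by (auto simp: trunc_def ell2_outside)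
    fix G assume G: "finite G" "G \<subseteq> I"
    have "(\<Sum>i\<in>G. (cmod (f i - trunc F f i))\<^sup>2) = (\<Sum>i\<in>G - F. ?h i)"
      using G by (intro sum.mono_neutral_cong_right) (auto simp: trunc_def)
    also have "\<dots> = sum ?h (F \<union> G) - sum ?h F"
      using G F sum.union_disjoint[of F "G - F" ?h] by simp
    also have "\<dots> \<le> infsum ?h I - sum ?h F"
      using G F by (intro diff_right_mono finite_sum_le_infsum ell2_summable assms) auto
    also have "\<dots> \<le> \<epsilon>\<^sup>2" using F0(3) F by (auto simp: dist_real_def)
    finally show "L2_set (\<lambda>i. cmod (f i - trunc F f i)) G \<le> \<epsilon>"
      using assms(2) by (simp add: L2_set_def real_le_lsqrt sum_nonneg)
  qed
  then show thesis using F0 that by blast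
qed

text \<open>Continuity of \<open>T\<close> and density of the finitely supported vectors, in coordinates.\<close>

lemma bounded_op_inner_has_sum:
  assumes T: "bounded_op I T" and f: "f \<in> ell2 I" and g: "g \<in> ell2 I"
  shows "((\<lambda>j. f j * ell2_inner I (T (delta j)) g) has_sum ell2_inner I (T f) g) I"
  unfolding has_sum_def
proof (rule tendstoI)
  fix e :: real assume e: "e > 0"
  obtain K where K: "K \<ge> 0" "\<And>f. f \<in> ell2 I \<Longrightarrow> ell2_norm I (T f) \<le> K * ell2_norm I f"
    using bounded_op_bound[OF T] by blast
  \<comment> \<open>The summand \<open>1\<close> keeps the denominator positive when \<open>K\<close> or \<open>g\<close> vanishes.\<close>
  define d where "d = e / (2 * (K * ell2_norm I g + 1))"
  have pos: "K * ell2_norm I g + 1 > 0" using K by (simp add: add_nonneg_pos)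
  have d: "d > 0" using e pos by (simp add: d_def)
  obtain F0 where F0: "finite F0" "F0 \<subseteq> I"
    "\<And>F. finite F \<Longrightarrow> F0 \<subseteq> F \<Longrightarrow> F \<subseteq> I \<Longrightarrow> ell2_norm I (\<lambda>i. f i - trunc F f i) \<le> d"
    using trunc_approx[OF f d] by blast
  have "dist (\<Sum>j\<in>F. f j * ell2_inner I (T (delta j)) g) (ell2_inner I (T f) g) < e"
    if F: "finite F" "F0 \<subseteq> F" "F \<subseteq> I" for F
  proof -
    have in1: "ell2_inner I (\<lambda>i. \<Sum>j\<in>G. f j * T (delta j) i) g =
        (\<Sum>j\<in>G. f j * ell2_inner I (T (delta j)) g)
        \<and> (\<lambda>i. \<Sum>j\<in>G. f j * T (delta j) i) \<in> ell2 I" if "finite G" for G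
      using that
    proof induction
      case empty
      then show ?case by (simp add: ell2_inner_def ell2_zero)
    next
      case (insert j G)
      then show ?case using T g
        by (simp add: ell2_inner_add_left ell2_inner_scale_left ell2_scale_le ell2_add)
    qed
    let ?r = "\<lambda>i. f i - trunc F f i"
    have tr: "trunc F f \<in> ell2 I" by (rule trunc_ell2) fact+
    have r: "?r \<in> ell2 I" using ell2_add(1)[OF f ell2_scale_le(1)[OF tr, of "-1"]] by simp
    have "f = (\<lambda>i. trunc F f i + ?r i)" by simp
    then have "T f = (\<lambda>i. T (trunc F f) i + T ?r i)"
      using bounded_opD(3)[OF T tr r] by simp
    then have "ell2_inner I (T f) g = ell2_inner I (T (trunc F f)) g + ell2_inner I (T ?r) g"
      using ell2_inner_add_left[of "T (trunc F f)" I "T ?r" g] T g by simp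
    then have "ell2_inner I (T f) g = (\<Sum>j\<in>F. f j * ell2_inner I (T (delta j)) g) + ell2_inner I (T ?r) g"
      using in1[OF F(1)] bounded_op_trunc[OF T F(1,3)] by simp
    then have "dist (\<Sum>j\<in>F. f j * ell2_inner I (T (delta j)) g) (ell2_inner I (T f) g)
        = cmod (ell2_inner I (T ?r) g)" by (simp add: dist_norm)
    also have "\<dots> \<le> ell2_norm I (T ?r) * ell2_norm I g"
      using T g by (intro ell2_inner_summable) auto
    also have "\<dots> \<le> (K * d) * ell2_norm I g"
      using K r F0(3)[OF F] by (intro mult_right_mono order_trans[OF K(2)[OF r]] mult_left_mono) auto
    also have "\<dots> = d * (K * ell2_norm I g)" by simp
    also have "\<dots> \<le> d * (K * ell2_norm I g + 1)" using d by simp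
    also have "\<dots> = e / 2" using pos by (simp add: d_def field_simps)
    also have "\<dots> < e" using e by simp
    finally show ?thesis .
  qed
  then show "\<forall>\<^sub>F F in finite_subsets_at_top I.
      dist (\<Sum>j\<in>F. f j * ell2_inner I (T (delta j)) g) (ell2_inner I (T f) g) < e"
    unfolding eventually_finite_subsets_at_top using F0 by blast
qed

text \<open>The adjoint is given by \<open>(U g)(j) = \<langle>g, T \<delta>\<^sub>j\<rangle>\<close>. Its values on finite sets are bounded by testing \<open>T\<close>
on the truncations of \<open>U g\<close> themselves.\<close>

lemma adjoint_exists:
  assumes T: "bounded_op I T" shows "\<exists>U. bounded_op I U \<and> is_adjoint I T U"
proof -
  define U where "U = (\<lambda>g j. if g \<in> ell2 I \<and> j \<in> I then ell2_inner I g (T (delta j)) else 0)"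
  obtain K where K: "K \<ge> 0" "\<And>f. f \<in> ell2 I \<Longrightarrow> ell2_norm I (T f) \<le> K * ell2_norm I f"
    using bounded_op_bound[OF T] by blast
  have L: "L2_set (\<lambda>j. cmod (U g j)) F \<le> K * ell2_norm I g"
    if g: "g \<in> ell2 I" and F: "finite F" "F \<subseteq> I" for g F
  proof -
    let ?L = "L2_set (\<lambda>j. cmod (U g j)) F"
    let ?h = "trunc F (U g)"
    have h: "?h \<in> ell2 I" "ell2_norm I ?h = ?L" using trunc_ell2[OF F] ell2_norm_trunc[OF F, of "U g"] F(1) by (simp_all add: L2_set_def trunc_def)
    have "ell2_inner I (T ?h) g = (\<Sum>\<^sub>\<infinity>j\<in>I. ?h j * ell2_inner I (T (delta j)) g)"
      using bounded_op_inner_has_sum[OF T h(1) g] by (simp add: infsumI)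
    also have "\<dots> = (\<Sum>\<^sub>\<infinity>j\<in>F. U g j * cnj (U g j))"
      using F g by (intro infsum_cong_neutral) (auto simp: trunc_def U_def ell2_inner_cnj)
    also have "\<dots> = of_real (?L\<^sup>2)"
      using F by (simp add: L2_set_def sum_nonneg complex_norm_square[symmetric])
    finally have "?L\<^sup>2 \<le> ell2_norm I (T ?h) * ell2_norm I g"
      using ell2_inner_summable(2)[of "T ?h" I g] T g by (simp add: norm_power)
    also have "\<dots> \<le> (K * ?L) * ell2_norm I g"
      using K(2)[OF h(1)] h(2) by (intro mult_right_mono) auto
    finally have *: "?L * ?L \<le> ?L * (K * ell2_norm I g)" by (simp add: power2_eq_square ac_simps)
    show ?thesis
    proof (cases "?L = 0")
      case True
      then show ?thesis using K by simp
    next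
      case False
      then have "?L > 0" by (simp add: order_less_le)
      then show ?thesis using * mult_le_cancel_left_pos by blast
    qed
  qed
  have "bounded_op I U"
  proof (rule bounded_opI[where K = K])
    fix f g :: "'a \<Rightarrow> complex" and c :: complex
    show "f \<in> ell2 I \<Longrightarrow> U f \<in> ell2 I"
      by (rule ell2_boundedI(1)[where B = "K * ell2_norm I f"]) (use L in \<open>auto simp: U_def\<close>)
    show "f \<in> ell2 I \<Longrightarrow> ell2_norm I (U f) \<le> K * ell2_norm I f"
      by (rule ell2_boundedI(2)) (use L in \<open>auto simp: U_def\<close>)
    show "f \<notin> ell2 I \<Longrightarrow> U f = (\<lambda>i. 0)" by (simp add: U_def)
    show "f \<in> ell2 I \<Longrightarrow> g \<in> ell2 I \<Longrightarrow> U (\<lambda>i. f i + g i) = (\<lambda>i. U f i + U g i)"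
      using T by (auto simp: U_def ell2_add ell2_inner_add_left)
    show "f \<in> ell2 I \<Longrightarrow> U (\<lambda>i. c * f i) = (\<lambda>i. c * U f i)"
      by (auto simp: U_def ell2_scale_le ell2_inner_scale_left)
  qed
  moreover have "is_adjoint I T U"
    unfolding is_adjoint_def
  proof (intro ballI)
    fix f g assume f: "f \<in> ell2 I" and g: "g \<in> ell2 I"
    have "ell2_inner I (T f) g = (\<Sum>\<^sub>\<infinity>j\<in>I. f j * ell2_inner I (T (delta j)) g)"
      using bounded_op_inner_has_sum[OF T f g] by (simp add: infsumI)
    also have "\<dots> = ell2_inner I f (U g)"
      unfolding ell2_inner_def[of I f] using g by (intro infsum_cong) (simp add: U_def ell2_inner_cnj)
    finally show "ell2_inner I (T f) g = ell2_inner I f (U g)" .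
  qed
  ultimately show ?thesis by blast
qed

lemma op_adjoint:
  assumes "bounded_op I T"
  shows "bounded_op I (op_adjoint I T)" "is_adjoint I T (op_adjoint I T)"
proof -
  obtain U where "bounded_op I U" "is_adjoint I T U" using adjoint_exists[OF assms] by blast
  moreover from this have "op_adjoint I T = U" by (rule op_adjoint_eqI)
  ultimately show "bounded_op I (op_adjoint I T)" "is_adjoint I T (op_adjoint I T)" by simp_all
qed

lemma bounded_op_eqI:
  assumes T: "bounded_op I T" "bounded_op I U" and "\<And>i. i \<in> I \<Longrightarrow> T (delta i) = U (delta i)"
  shows "T = U"
proof
  fix f show "T f = U f"
  proof (cases "f \<in> ell2 I")
    case True
    show ?thesis
    proof
      fix i show "T f i = U f i"
      proof (cases "i \<in> I")
        case i: True
        have "((\<lambda>j. f j * ell2_inner I (T (delta j)) (delta i)) has_sum T f i) I"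
          "((\<lambda>j. f j * ell2_inner I (U (delta j)) (delta i)) has_sum U f i) I"
          using bounded_op_inner_has_sum[OF _ True delta_ell2[OF i]] T i by (simp_all add: ell2_inner_delta)
        moreover have "((\<lambda>j. f j * ell2_inner I (T (delta j)) (delta i)) has_sum T f i) I
            = ((\<lambda>j. f j * ell2_inner I (U (delta j)) (delta i)) has_sum T f i) I"
          using assms(3) by (intro has_sum_cong) simp
        ultimately show ?thesis using has_sum_unique by blast
      qed (simp add: ell2_outside[OF bounded_op_closed[OF T(1)]] ell2_outside[OF bounded_op_closed[OF T(2)]])
    qed
  qed (simp add: bounded_opD(2)[OF T(1)] bounded_opD(2)[OF T(2)])
qed

lemma bounded_op_one: "bounded_op I (\<lambda>f. if f \<in> ell2 I then f else (\<lambda>i. 0))"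
  by (rule bounded_opI[where K = 1]) (auto simp: ell2_add ell2_scale_le)

lemma bounded_op_zero_op: "bounded_op I (\<lambda>f i. 0)"
  by (rule bounded_opI[where K = 0]) (auto simp: ell2_zero)

lemma bounded_op_add:
  assumes "bounded_op I T" "bounded_op I U" shows "bounded_op I (\<lambda>f i. T f i + U f i)"
proof -
  obtain K where K: "K \<ge> 0" "\<And>f. f \<in> ell2 I \<Longrightarrow> ell2_norm I (T f) \<le> K * ell2_norm I f"
    using bounded_op_bound[OF assms(1)] by blast
  obtain L where L: "L \<ge> 0" "\<And>f. f \<in> ell2 I \<Longrightarrow> ell2_norm I (U f) \<le> L * ell2_norm I f"
    using bounded_op_bound[OF assms(2)] by blast
  show ?thesis
  proof (rule bounded_opI[where K = "K + L"])
    fix f assume f: "f \<in> ell2 I"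
    have "ell2_norm I (\<lambda>i. T f i + U f i) \<le> ell2_norm I (T f) + ell2_norm I (U f)"
      using assms by (simp add: ell2_add)
    then show "ell2_norm I (\<lambda>i. T f i + U f i) \<le> (K + L) * ell2_norm I f"
      using K(2)[OF f] L(2)[OF f] by (simp add: distrib_right)
  qed (use assms in \<open>auto simp: ell2_add bounded_opD(2-4) algebra_simps\<close>)
qed

lemma bounded_op_scale:
  assumes "bounded_op I T" shows "bounded_op I (op_scale c T)"
proof -
  obtain K where K: "K \<ge> 0" "\<And>f. f \<in> ell2 I \<Longrightarrow> ell2_norm I (T f) \<le> K * ell2_norm I f"
    using bounded_op_bound[OF assms(1)] by blast
  show ?thesis unfolding op_scale_def
  proof (rule bounded_opI[where K = "cmod c * K"])
    fix f assume f: "f \<in> ell2 I"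
    show "ell2_norm I (\<lambda>i. c * T f i) \<le> (cmod c * K) * ell2_norm I f"
      using assms K(2)[OF f] by (simp add: ell2_norm_scale mult.assoc mult_left_mono)
  qed (use assms in \<open>auto simp: ell2_scale_le bounded_opD(2-4) algebra_simps\<close>)
qed

lemma bounded_op_mult:
  assumes "bounded_op I T" "bounded_op I U" shows "bounded_op I (\<lambda>f. T (U f))"
proof -
  obtain K where K: "K \<ge> 0" "\<And>f. f \<in> ell2 I \<Longrightarrow> ell2_norm I (T f) \<le> K * ell2_norm I f"
    using bounded_op_bound[OF assms(1)] by blast
  obtain L where L: "L \<ge> 0" "\<And>f. f \<in> ell2 I \<Longrightarrow> ell2_norm I (U f) \<le> L * ell2_norm I f"
    using bounded_op_bound[OF assms(2)] by blast
  show ?thesis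
  proof (rule bounded_opI[where K = "K * L"])
    fix f assume f: "f \<in> ell2 I"
    have "ell2_norm I (T (U f)) \<le> K * ell2_norm I (U f)" using K assms by simp
    also have "\<dots> \<le> K * (L * ell2_norm I f)" using K L(2)[OF f] by (simp add: mult_left_mono)
    finally show "ell2_norm I (T (U f)) \<le> (K * L) * ell2_norm I f" by (simp add: mult.assoc)
  qed (use assms in \<open>auto simp: bounded_opD(2-4)[OF assms(2)] bounded_opD(3,4)[OF assms(1)] bounded_op_zero\<close>)
qed

lemma adjoint_one: "is_adjoint I (\<lambda>f. if f \<in> ell2 I then f else (\<lambda>i. 0)) (\<lambda>f. if f \<in> ell2 I then f else (\<lambda>i. 0))"
  by (simp add: is_adjoint_def)

lemma adjoint_zero: "op_adjoint I (\<lambda>f i. 0) = (\<lambda>f i. 0)"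
  by (rule op_adjoint_eqI) (auto simp: is_adjoint_def bounded_op_zero_op ell2_inner_def)

lemma adjoint_mult:
  assumes "bounded_op I T" "bounded_op I U" "bounded_op I T'" "is_adjoint I T T'" "is_adjoint I U U'"
  shows "is_adjoint I (\<lambda>f. T (U f)) (\<lambda>f. U' (T' f))"
  using assms unfolding is_adjoint_def by simp

lemma adjoint_add:
  assumes "bounded_op I T" "bounded_op I U" "bounded_op I T'" "bounded_op I U'"
    "is_adjoint I T T'" "is_adjoint I U U'"
  shows "is_adjoint I (\<lambda>f i. T f i + U f i) (\<lambda>f i. T' f i + U' f i)"
  using assms unfolding is_adjoint_def by (simp add: ell2_inner_add_left ell2_inner_add_right)

lemma adjoint_scale:
  assumes "is_adjoint I T T'" shows "is_adjoint I (op_scale c T) (op_scale (cnj c) T')"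
  using assms unfolding is_adjoint_def op_scale_def by (simp add: ell2_inner_scale_left ell2_inner_scale_right)

lemma ell2_norm_le_op_norm:
  assumes T: "bounded_op I T" and f: "f \<in> ell2 I"
  shows "ell2_norm I (T f) \<le> op_norm I T * ell2_norm I f"
proof -
  obtain K where K: "K \<ge> 0" "\<And>f. f \<in> ell2 I \<Longrightarrow> ell2_norm I (T f) \<le> K * ell2_norm I f"
    using bounded_op_bound[OF T] by blast
  have bdd: "bdd_above ((\<lambda>f. ell2_norm I (T f)) ` {f \<in> ell2 I. ell2_norm I f \<le> 1})"
  proof (rule bdd_aboveI2)
    fix g assume g: "g \<in> {f \<in> ell2 I. ell2_norm I f \<le> 1}"
    then show "ell2_norm I (T g) \<le> K * 1"
      using K by (intro order_trans[OF K(2)] mult_left_mono) auto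
  qed
  show ?thesis
  proof (cases "ell2_norm I f = 0")
    case True
    then show ?thesis using K(2)[OF f] by simp
  next
    case False
    define n where "n = ell2_norm I f"
    have n: "n > 0" using False by (simp add: n_def order_less_le)
    let ?g = "\<lambda>i. of_real (1 / n) * f i"
    have "?g \<in> {f \<in> ell2 I. ell2_norm I f \<le> 1}"
      using f n ell2_norm_scale[OF f, of "of_real (1 / n)"] ell2_scale_le(1)[OF f, of "of_real (1 / n)"]
      by (simp add: n_def[symmetric] norm_divide)
    then have "ell2_norm I (T ?g) \<le> op_norm I T" unfolding op_norm_def by (rule cSUP_upper) (rule bdd)
    moreover have "ell2_norm I (T ?g) = (1 / n) * ell2_norm I (T f)"
      using bounded_opD(4)[OF T f, of "of_real (1 / n)"] T n ell2_norm_scale[of "T f" I "of_real (1 / n)"] by (simp add: norm_divide)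
    ultimately have "(1 / n) * ell2_norm I (T f) \<le> op_norm I T" by (simp only:)
    then show ?thesis using n by (simp add: n_def[symmetric] field_simps)
  qed
qed

text \<open>Norm convergence implies convergence of every coordinate.\<close>

lemma op_norm_limit_coord:
  assumes X: "\<And>n. bounded_op I (X n)" and T: "bounded_op I T"
    and lim: "(\<lambda>n. op_norm I (\<lambda>f i. X n f i + op_scale (- 1) T f i)) \<longlonglongrightarrow> 0"
  shows "(\<lambda>n::nat. X n f i) \<longlonglongrightarrow> T f i"
proof (cases "f \<in> ell2 I")
  case False
  then show ?thesis using bounded_opD(2)[OF X] bounded_opD(2)[OF T] by simp
next
  case True
  let ?D = "\<lambda>n f i. X n f i + op_scale (- 1) T f i"
  have D: "bounded_op I (?D n)" for n using X T by (intro bounded_op_add bounded_op_scale)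
  have bd: "norm (X n f i - T f i) \<le> op_norm I (?D n) * ell2_norm I f" for n
  proof -
    have "cmod (?D n f i) \<le> ell2_norm I (?D n f)" by (intro ell2_coord_le bounded_op_closed[OF D])
    also have "\<dots> \<le> op_norm I (?D n) * ell2_norm I f" using D True by (rule ell2_norm_le_op_norm)
    finally show ?thesis by (simp add: op_scale_def)
  qed
  have lim0: "(\<lambda>n. op_norm I (?D n) * ell2_norm I f) \<longlonglongrightarrow> 0"
    using tendsto_mult_right[OF lim, of "ell2_norm I f"] by simp
  have "(\<lambda>n. X n f i - T f i) \<longlonglongrightarrow> 0"
    by (rule Lim_null_comparison[OF always_eventually[OF allI[OF bd]] lim0])
  then show ?thesis by (simp add: LIM_zero_iff)
qed

lemma unitary_simps [simp]:
  "mult (unitary_group I) = (\<lambda>T U f. T (U f))"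
  "one (unitary_group I) = (\<lambda>f. if f \<in> ell2 I then f else (\<lambda>i. 0))"
  "U \<in> carrier (unitary_group I) \<longleftrightarrow> bounded_op I U \<and>
     (\<lambda>f. op_adjoint I U (U f)) = (\<lambda>f. if f \<in> ell2 I then f else (\<lambda>i. 0)) \<and>
     (\<lambda>f. U (op_adjoint I U f)) = (\<lambda>f. if f \<in> ell2 I then f else (\<lambda>i. 0))"
  by (simp_all add: unitary_group_def bounded_ops_def)

lemma is_cstar_iff:
  "is_cstar_subalgebra I B \<longleftrightarrow> (\<forall>T\<in>B. bounded_op I T) \<and> (\<lambda>f i. 0) \<in> B \<and>
     (\<forall>T\<in>B. \<forall>U\<in>B. (\<lambda>f i. T f i + U f i) \<in> B \<and> (\<lambda>f. T (U f)) \<in> B) \<and>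
     (\<forall>c. \<forall>T\<in>B. op_scale c T \<in> B) \<and> (\<forall>T\<in>B. op_adjoint I T \<in> B) \<and>
     (\<forall>X T. (\<forall>n::nat. X n \<in> B) \<longrightarrow> bounded_op I T \<longrightarrow>
        (\<lambda>n. op_norm I (\<lambda>f i. X n f i + op_scale (- 1) T f i)) \<longlonglongrightarrow> 0 \<longrightarrow> T \<in> B)"
  by (auto simp: is_cstar_subalgebra_def bounded_ops_def Let_def)

lemma is_cstar_all: "is_cstar_subalgebra I {T. bounded_op I T}"
  unfolding is_cstar_iff
  using bounded_op_mult[of I] bounded_op_add[of I]
  by (auto simp: bounded_op_zero_op bounded_op_scale op_adjoint)

text \<open>The operator \<open>f \<mapsto> (w \<mapsto> a w \<sqdot> f w + d \<sqdot> f (\<rho> w))\<close>. With \<open>\<rho>\<close> left or right multiplication by a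
generator, this is the shape of the generators of the Hecke representation and of its right-hand analogue.\<close>

definition refl_op :: "'i set \<Rightarrow> ('i \<Rightarrow> 'i) \<Rightarrow> ('i \<Rightarrow> real) \<Rightarrow> real \<Rightarrow> 'i operator" where
  "refl_op I \<rho> a d f = (\<lambda>w. if f \<in> ell2 I \<and> w \<in> I
     then of_real (a w) * f w + of_real d * f (\<rho> w) else 0)"

lemma refl_op_bounded:
  assumes \<rho>: "\<And>w. w \<in> I \<Longrightarrow> \<rho> w \<in> I" "\<And>w. w \<in> I \<Longrightarrow> \<rho> (\<rho> w) = w"
    and a: "\<And>w. w \<in> I \<Longrightarrow> \<bar>a w\<bar> \<le> 1"
  shows "bounded_op I (refl_op I \<rho> a d)"
proof -
  have inj: "inj_on \<rho> I" using \<rho>(2) by (metis inj_onI)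
  have b: "L2_set (\<lambda>w. cmod (refl_op I \<rho> a d f w)) F \<le> (1 + \<bar>d\<bar>) * ell2_norm I f"
    if f: "f \<in> ell2 I" and F: "finite F" "F \<subseteq> I" for f F
  proof -
    have "L2_set (\<lambda>w. cmod (refl_op I \<rho> a d f w)) F
        \<le> L2_set (\<lambda>w. cmod (f w) + \<bar>d\<bar> * cmod (f (\<rho> w))) F"
    proof (rule L2_set_mono)
      fix w assume w: "w \<in> F"
      then have "cmod (of_real (a w) * f w) \<le> 1 * cmod (f w)"
        using a F unfolding norm_mult by (intro mult_right_mono) auto
      then show "cmod (refl_op I \<rho> a d f w) \<le> cmod (f w) + \<bar>d\<bar> * cmod (f (\<rho> w))"
        using w F norm_triangle_ineq[of "of_real (a w) * f w" "of_real d * f (\<rho> w)"]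
        by (auto simp: refl_op_def norm_mult)
    qed simp
    also have "\<dots> \<le> L2_set (\<lambda>w. cmod (f w)) F + L2_set (\<lambda>w. \<bar>d\<bar> * cmod (f (\<rho> w))) F"
      by (rule L2_set_triangle_ineq)
    also have "L2_set (\<lambda>w. \<bar>d\<bar> * cmod (f (\<rho> w))) F = \<bar>d\<bar> * L2_set (\<lambda>w. cmod (f w)) (\<rho> ` F)"
      using inj_on_subset[OF inj F(2)]
      by (simp add: L2_set_right_distrib[symmetric]) (simp add: L2_set_def sum.reindex)
    also have "L2_set (\<lambda>w. cmod (f w)) F + \<bar>d\<bar> * L2_set (\<lambda>w. cmod (f w)) (\<rho> ` F)
        \<le> ell2_norm I f + \<bar>d\<bar> * ell2_norm I f"
      using F \<rho>(1) by (intro add_mono mult_left_mono L2_set_le_ell2_norm f) auto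
    finally show ?thesis by (simp add: distrib_right)
  qed
  show ?thesis
  proof (rule bounded_opI[where K = "1 + \<bar>d\<bar>"])
    fix f g :: "'a \<Rightarrow> complex" and c :: complex
    show "f \<in> ell2 I \<Longrightarrow> refl_op I \<rho> a d f \<in> ell2 I"
      by (rule ell2_boundedI(1)[where B = "(1 + \<bar>d\<bar>) * ell2_norm I f"]) (use b in \<open>auto simp: refl_op_def\<close>)
    show "f \<in> ell2 I \<Longrightarrow> ell2_norm I (refl_op I \<rho> a d f) \<le> (1 + \<bar>d\<bar>) * ell2_norm I f"
      by (rule ell2_boundedI(2)) (use b in \<open>auto simp: refl_op_def\<close>)
  qed (auto simp: refl_op_def ell2_add ell2_scale_le algebra_simps)
qed

lemma refl_op_selfadjoint:
  assumes \<rho>: "\<And>w. w \<in> I \<Longrightarrow> \<rho> w \<in> I" "\<And>w. w \<in> I \<Longrightarrow> \<rho> (\<rho> w) = w"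
    and a: "\<And>w. w \<in> I \<Longrightarrow> \<bar>a w\<bar> \<le> 1"
  shows "is_adjoint I (refl_op I \<rho> a d) (refl_op I \<rho> a d)"
  unfolding is_adjoint_def
proof (intro ballI)
  fix f g assume f: "f \<in> ell2 I" and g: "g \<in> ell2 I"
  \<comment> \<open>Both the diagonal part and composition with the involution \<open>\<rho>\<close> are self-adjoint.\<close>
  let ?A = "\<lambda>f. refl_op I \<rho> a 0 f" and ?B = "\<lambda>f. refl_op I \<rho> (\<lambda>_. 0) 1 f"
  have A: "?A f \<in> ell2 I" "?A g \<in> ell2 I" and B: "?B f \<in> ell2 I" "?B g \<in> ell2 I"
    using refl_op_bounded[of I \<rho> a 0] refl_op_bounded[of I \<rho> "\<lambda>_. 0" 1] assms by simp_all
  have split: "refl_op I \<rho> a d h = (\<lambda>w. ?A h w + of_real d * ?B h w)" for h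
    by (auto simp: refl_op_def)
  have bij: "bij_betw \<rho> I I" using \<rho> by (intro bij_betw_byWitness[where f' = \<rho>]) auto
  have "ell2_inner I (?B f) g = (\<Sum>\<^sub>\<infinity>w\<in>I. f (\<rho> w) * cnj (g w))"
    unfolding ell2_inner_def using f by (intro infsum_cong) (simp add: refl_op_def)
  also have "\<dots> = (\<Sum>\<^sub>\<infinity>w\<in>I. f (\<rho> (\<rho> w)) * cnj (g (\<rho> w)))"
    using infsum_reindex_bij_betw[OF bij, of "\<lambda>w. f (\<rho> w) * cnj (g w)"] by simp
  also have "\<dots> = ell2_inner I f (?B g)"
    unfolding ell2_inner_def using g \<rho> by (intro infsum_cong) (simp add: refl_op_def)
  finally have 1: "ell2_inner I (?B f) g = ell2_inner I f (?B g)" .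
  have 2: "ell2_inner I (?A f) g = ell2_inner I f (?A g)"
    unfolding ell2_inner_def using f g by (intro infsum_cong) (simp add: refl_op_def)
  show "ell2_inner I (refl_op I \<rho> a d f) g = ell2_inner I f (refl_op I \<rho> a d g)"
    unfolding split using A B f g 1 2
    by (simp add: ell2_inner_add_left ell2_inner_add_right ell2_scale_le ell2_inner_scale_left
        ell2_inner_scale_right)
qed

section \<open>The Hecke representation\<close>

locale right_angled_hecke = right_angled +
  fixes q :: "'a \<Rightarrow> real"
  assumes q: "\<And>s. s \<in> S \<Longrightarrow> 0 < q s \<and> q s \<le> 1"
begin

abbreviation "W \<equiv> carrier (racg S m)"

text \<open>The coefficients in the Hecke representation.\<close>

definition hecke_c :: "'a \<Rightarrow> real" where "hecke_c s = (1 - q s) / (1 + q s)"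
definition hecke_d :: "'a \<Rightarrow> real" where "hecke_d s = 2 * sqrt (q s) / (1 + q s)"

lemma hecke_c_d_squares: assumes "s \<in> S" shows "(hecke_c s)\<^sup>2 + (hecke_d s)\<^sup>2 = 1"
proof -
  have p: "1 + q s \<noteq> 0" using q[OF assms] by simp
  have "(hecke_c s)\<^sup>2 + (hecke_d s)\<^sup>2 = ((1 - q s)\<^sup>2 + 4 * q s) / (1 + q s)\<^sup>2"
    using q[OF assms] by (simp add: hecke_c_def hecke_d_def power_divide power_mult_distrib add_divide_distrib)
  also have "(1 - q s)\<^sup>2 + 4 * q s = (1 + q s)\<^sup>2" by (simp add: power2_eq_square algebra_simps)
  finally show ?thesis using p by simp
qed

lemma hecke_d_nz: "s \<in> S \<Longrightarrow> hecke_d s \<noteq> 0"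
  using q[of s] by (simp add: hecke_d_def)

lemma hecke_c_abs: "s \<in> S \<Longrightarrow> \<bar>hecke_c s\<bar> \<le> 1"
  using hecke_c_d_squares[of s] abs_square_le_1[of "hecke_c s"] by (metis le_add_same_cancel1 zero_le_power2)

text \<open>The diagonal coefficient at \<open>w\<close>, whose sign depends on whether \<open>s\<close> lengthens \<open>w\<close>.\<close>

definition diag_coeff :: "'a \<Rightarrow> 'a word set \<Rightarrow> real" where
  "diag_coeff s w = (if up s w then hecke_c s else - hecke_c s)"

lemma diag_coeff_abs: "s \<in> S \<Longrightarrow> \<bar>diag_coeff s w\<bar> \<le> 1"
  using hecke_c_abs by (simp add: diag_coeff_def)

text \<open>The operator \<open>\<lambda>\<^sub>q(s)\<close>.\<close>

definition T :: "'a \<Rightarrow> 'a word set operator" where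
  "T s = refl_op W (lmult s) (diag_coeff s) (hecke_d s)"

text \<open>The right-hand analogue of \<open>T\<close>: the coefficient now depends on whether right multiplication by
\<open>t\<close> lengthens \<open>w\<close>.\<close>

definition R :: "'a \<Rightarrow> 'a word set operator" where
  "R t = refl_op W (rmult t) (\<lambda>w. diag_coeff t (winv w)) (hecke_d t)"

lemma T_bounded [simp]: "s \<in> S \<Longrightarrow> bounded_op W (T s)"
  unfolding T_def by (intro refl_op_bounded) (simp_all add: lmult_carrier lmult_lmult diag_coeff_abs)

lemma R_bounded [simp]: "s \<in> S \<Longrightarrow> bounded_op W (R s)"
  unfolding R_def by (intro refl_op_bounded) (simp_all add: rmult_carrier rmult_rmult diag_coeff_abs)

lemma T_adj: "s \<in> S \<Longrightarrow> is_adjoint W (T s) (T s)"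
  unfolding T_def by (intro refl_op_selfadjoint) (simp_all add: lmult_carrier lmult_lmult diag_coeff_abs)

lemma R_adj: "s \<in> S \<Longrightarrow> is_adjoint W (R s) (R s)"
  unfolding R_def by (intro refl_op_selfadjoint) (simp_all add: rmult_carrier rmult_rmult diag_coeff_abs)

lemma T_apply: "f \<in> ell2 W \<Longrightarrow> w \<in> W \<Longrightarrow> T s f w = of_real (diag_coeff s w) * f w + of_real (hecke_d s) * f (lmult s w)"
  by (simp add: T_def refl_op_def)

lemma R_apply: "f \<in> ell2 W \<Longrightarrow> w \<in> W \<Longrightarrow> R s f w = of_real (diag_coeff s (winv w)) * f w + of_real (hecke_d s) * f (rmult s w)"
  by (simp add: R_def refl_op_def)

lemma diag_coeff_lmult: "s \<in> S \<Longrightarrow> w \<in> W \<Longrightarrow> diag_coeff s (lmult s w) = - diag_coeff s w"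
  by (simp add: diag_coeff_def up_lmult)

lemma T_delta:
  assumes s: "s \<in> S" and w: "w \<in> W"
  shows "T s (delta w) = (\<lambda>v. of_real (diag_coeff s w) * delta w v + of_real (hecke_d s) * delta (lmult s w) v)"
proof (rule ell2_eqI[where I = W])
  have lw: "lmult s w \<in> W" using lmult_carrier s w .
  show "(\<lambda>v. of_real (diag_coeff s w) * delta w v + of_real (hecke_d s) * delta (lmult s w) v) \<in> ell2 W"
    by (intro ell2_add ell2_scale_le delta_ell2 w lw)
  show "T s (delta w) \<in> ell2 W" using s by simp
  fix v assume v: "v \<in> W"
  have "lmult s v = w \<longleftrightarrow> v = lmult s w" using lmult_lmult s w v by metis
  then show "T s (delta w) v = of_real (diag_coeff s w) * delta w v + of_real (hecke_d s) * delta (lmult s w) v"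
    using v T_apply[OF delta_ell2[OF w] v] by (auto simp: delta_def)
qed

lemma R_delta:
  assumes s: "s \<in> S" and w: "w \<in> W"
  shows "R s (delta w) = (\<lambda>v. of_real (diag_coeff s (winv w)) * delta w v + of_real (hecke_d s) * delta (rmult s w) v)"
proof (rule ell2_eqI[where I = W])
  have lw: "rmult s w \<in> W" using rmult_carrier s w .
  show "(\<lambda>v. of_real (diag_coeff s (winv w)) * delta w v + of_real (hecke_d s) * delta (rmult s w) v) \<in> ell2 W"
    by (intro ell2_add ell2_scale_le delta_ell2 w lw)
  show "R s (delta w) \<in> ell2 W" using s by simp
  fix v assume v: "v \<in> W"
  have "rmult s v = w \<longleftrightarrow> v = rmult s w" using rmult_rmult s w v by metis
  then show "R s (delta w) v = of_real (diag_coeff s (winv w)) * delta w v + of_real (hecke_d s) * delta (rmult s w) v"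
    using v R_apply[OF delta_ell2[OF w] v] by (auto simp: delta_def)
qed

lemma T_T: assumes s: "s \<in> S" and f: "f \<in> ell2 W" shows "T s (T s f) = f"
proof (rule ell2_eqI[where I = W])
  fix w assume w: "w \<in> W"
  have lw: "lmult s w \<in> W" using lmult_carrier s w .
  have *: "(diag_coeff s w)\<^sup>2 + (hecke_d s)\<^sup>2 = 1" using hecke_c_d_squares[OF s] by (simp add: diag_coeff_def)
  have Tf: "T s f \<in> ell2 W" using s by simp
  have "T s (T s f) w = of_real ((diag_coeff s w)\<^sup>2 + (hecke_d s)\<^sup>2) * f w"
    using T_apply[OF Tf w] T_apply[OF f w] T_apply[OF f lw] lmult_lmult[OF s w] diag_coeff_lmult[OF s w]
    by (simp add: power2_eq_square algebra_simps)
  then show "T s (T s f) w = f w" using * by simp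
qed (use assms in simp_all)

lemma T_commuting: assumes c: "commuting s t" and f: "f \<in> ell2 W" shows "T s (T t f) = T t (T s f)"
proof (rule ell2_eqI[where I = W])
  have s: "s \<in> S" and t: "t \<in> S" using c by (auto simp: commuting_def)
  show "T s (T t f) \<in> ell2 W" "T t (T s f) \<in> ell2 W" using s t by simp_all
  fix w assume w: "w \<in> W"
  have lw: "lmult s w \<in> W" "lmult t w \<in> W" using lmult_carrier s t w by blast+
  have Tf: "T s f \<in> ell2 W" "T t f \<in> ell2 W" using s t by simp_all
  have e: "diag_coeff s (lmult t w) = diag_coeff s w" "diag_coeff t (lmult s w) = diag_coeff t w"
    using up_commuting[OF c w] up_commuting[OF commuting_sym[OF c] w] by (simp_all add: diag_coeff_def)
  show "T s (T t f) w = T t (T s f) w"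
    using T_apply[OF Tf(1) w] T_apply[OF Tf(2) w] T_apply[OF f w] T_apply[OF f lw(1)] T_apply[OF f lw(2)]
      e lmult_commuting[OF c w] by (simp add: algebra_simps)
qed

text \<open>Left and right operators commute. The off-diagonal terms agree by the exchange property unless
\<open>s = t\<close> and \<open>sw = wt\<close>, in which case both sides of \<open>key\<close> are \<open>2 d\<^sub>s\<close> times the common diagonal
coefficient times \<open>f(sw)\<close>.\<close>

lemma T_R: assumes s: "s \<in> S" and t: "t \<in> S" and f: "f \<in> ell2 W" shows "T s (R t f) = R t (T s f)"
proof (rule ell2_eqI[where I = W])
  show "T s (R t f) \<in> ell2 W" "R t (T s f) \<in> ell2 W" using s t by simp_all
  fix w assume w: "w \<in> W"
  have lw: "lmult s w \<in> W" "rmult t w \<in> W" using lmult_carrier rmult_carrier s t w by blast+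
  have Tf: "T s f \<in> ell2 W" "R t f \<in> ell2 W" using s t by simp_all
  have key: "of_real (hecke_d t) * of_real (diag_coeff s w - diag_coeff s (rmult t w)) * f (rmult t w)
      = of_real (hecke_d s) * of_real (diag_coeff t (winv w) - diag_coeff t (winv (lmult s w))) * f (lmult s w)"
  proof (cases "s = t \<and> lmult s w = rmult t w")
    case True
    then have same: "s = t" and eq: "lmult s w = rmult t w" by auto
    have "diag_coeff s w = diag_coeff t (winv w)" using up_eq_winv[of s w] same eq by (simp add: diag_coeff_def)
    moreover have "diag_coeff s (rmult t w) = - diag_coeff s w" using eq diag_coeff_lmult[OF s w] by metis
    moreover have "diag_coeff t (winv (lmult s w)) = - diag_coeff t (winv w)"
      using eq diag_coeff_lmult[OF t winv_carrier[OF w]] by (simp add: rmult_def)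
    ultimately show ?thesis using same eq by simp
  next
    case False
    then have "up s (rmult t w) = up s w" "up t (winv (lmult s w)) = up t (winv w)"
      using up_rmult[OF s t w] up_winv_lmult[OF s t w] by blast+
    then have "diag_coeff s (rmult t w) = diag_coeff s w" "diag_coeff t (winv (lmult s w)) = diag_coeff t (winv w)"
      by (simp_all add: diag_coeff_def)
    then show ?thesis by simp
  qed
  show "T s (R t f) w = R t (T s f) w"
    using T_apply[OF Tf(2) w] R_apply[OF Tf(1) w] T_apply[OF f w] R_apply[OF f w]
      T_apply[OF f lw(2)] R_apply[OF f lw(1)] lmult_rmult[OF s t w] key by (simp add: algebra_simps)
qed

text \<open>The identity operator.\<close>

definition oneW :: "'a word set operator" where
  "oneW f = (if f \<in> ell2 W then f else (\<lambda>i. 0))"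

lemma oneW_eq: "oneW = (\<lambda>f. if f \<in> ell2 W then f else (\<lambda>i. 0))"
  by (simp add: fun_eq_iff oneW_def)

lemma oneW_in [simp]: "oneW f \<in> ell2 W"
  by (simp add: oneW_def ell2_zero)

lemma oneW_id [simp]: "f \<in> ell2 W \<Longrightarrow> oneW f = f"
  by (simp add: oneW_def)

text \<open>The product of the operators \<open>T s\<close> along a word.\<close>

definition Tword :: "'a list \<Rightarrow> 'a word set operator" where
  "Tword v = (\<lambda>f. foldr T v (oneW f))"

lemma Tword_Nil: "Tword [] = oneW" and Tword_Cons: "Tword (s # v) = (\<lambda>f. T s (Tword v f))"
  by (simp_all add: Tword_def)

lemma Tword_bounded: "v \<in> lists S \<Longrightarrow> bounded_op W (Tword v)"
proof (induction v)
  case Nil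
  show ?case using bounded_op_one[of W] by (simp add: Tword_Nil oneW_eq)
next
  case (Cons s v)
  then show ?case using bounded_op_mult[of W "T s" "Tword v"] by (simp add: Tword_Cons)
qed

lemma Tword_append: "v \<in> lists S \<Longrightarrow> Tword (u @ v) = (\<lambda>f. Tword u (Tword v f))"
  using bounded_op_closed[OF Tword_bounded[of v]] by (simp add: Tword_def fun_eq_iff)

lemma Tword_single: "s \<in> S \<Longrightarrow> Tword [s] = T s"
  using bounded_opD(2)[OF T_bounded[of s]] bounded_op_zero[OF T_bounded[of s]]
  by (auto simp: Tword_def oneW_def fun_eq_iff)

lemma Tword_adj: "v \<in> lists S \<Longrightarrow> is_adjoint W (Tword v) (Tword (rev v))"
proof (induction v)
  case Nil
  show ?case using adjoint_one[of W] by (simp add: Tword_Nil oneW_eq)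
next
  case (Cons s v)
  then have "is_adjoint W (\<lambda>f. T s (Tword v f)) (\<lambda>f. Tword (rev v) (T s f))"
    by (intro adjoint_mult[of W "T s" "Tword v" "T s" "Tword (rev v)"]) (simp_all add: Tword_bounded T_adj)
  moreover have "Tword (rev v @ [s]) = (\<lambda>f. Tword (rev v) (T s f))"
    using Cons by (simp add: Tword_append Tword_single)
  ultimately show ?case by (simp add: Tword_Cons)
qed

lemma Tword_star: "v \<in> lists S \<Longrightarrow> op_adjoint W (Tword v) = Tword (rev v)"
  by (intro op_adjoint_eqI Tword_adj Tword_bounded) simp_all

lemma Tword_square: "s \<in> S \<Longrightarrow> v \<in> lists S \<Longrightarrow> Tword (s # s # v) = Tword v"
  using T_T bounded_op_closed[OF Tword_bounded[of v]] by (simp add: Tword_Cons)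

lemma Tword_cancel_rev: "v \<in> lists S \<Longrightarrow> Tword (rev v @ v) = oneW"
proof (induction v)
  case Nil
  show ?case by (simp add: Tword_Nil)
next
  case (Cons s v)
  then have "Tword (rev v @ s # s # v) = Tword (rev v @ v)"
    using Tword_append[of "s # s # v" "rev v"] Tword_append[of v "rev v"] Tword_square[of s v] by simp
  then show ?case using Cons by simp
qed

lemma weq_Tword: "weq u v \<Longrightarrow> Tword (map fst u) = Tword (map fst v)"
proof (induction rule: pres_eq.induct)
  case (cancel u v s b)
  have l: "map fst v \<in> lists S" using fst_words[OF cancel(2)] .
  then show ?case using Tword_append[of "s # s # map fst v" "map fst u"] Tword_append[of "map fst v" "map fst u"]
      Tword_square[of s "map fst v"] cancel by simp
next
  case (relation u v x y)
  have l: "map fst v \<in> lists S" using fst_words[OF relation(2)] .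
  have "Tword (map fst x @ map fst v) = Tword (map fst y @ map fst v)"
    using relation(3) unfolding racg_relations_def
  proof (elim UnE CollectE exE conjE)
    fix s assume "(x, y) = ([(s, True), (s, True)], [])" "s \<in> S"
    then show ?thesis using Tword_square[of s "map fst v"] l by simp
  next
    fix s t assume "(x, y) = ([(s, True), (t, True)], [(t, True), (s, True)])"
      "s \<in> S" "t \<in> S" "m s t = 2"
    then show ?thesis using T_commuting[of s t] bounded_op_closed[OF Tword_bounded[OF l]] by (simp add: Tword_Cons commuting_def)
  qed
  then show ?case
    using Tword_append[of "map fst x @ map fst v" "map fst u"] Tword_append[of "map fst y @ map fst v" "map fst u"]
      l fst_words[OF relation(4)] fst_words[OF relation(5)] by simp
qed auto

text \<open>The Hecke representation. The value at a group element does not depend on the representative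
(\<open>weq_Tword\<close>).\<close>

definition rep :: "'a word set \<Rightarrow> 'a word set operator" where
  "rep = (\<lambda>w\<in>W. Tword (map fst (SOME u. u \<in> w)))"

lemma rep_cls: assumes "v \<in> lists S" shows "rep (cls v) = Tword v"
proof -
  have "emb v \<in> cls v" using assms by (simp add: cls_def word_class_def pres_eq.refl)
  then have "(SOME u. u \<in> cls v) \<in> cls v" by (rule someI)
  then have "weq (emb v) (SOME u. u \<in> cls v)" by (simp add: cls_def word_class_def)
  then show ?thesis using weq_Tword[of "emb v"] assms by (simp add: rep_def)
qed

lemma Tword_unitary: assumes v: "v \<in> lists S" shows "Tword v \<in> carrier (unitary_group W)"
proof -
  have "(\<lambda>f. Tword (rev v) (Tword v f)) = oneW" using Tword_append[OF v, of "rev v"] Tword_cancel_rev[OF v] by simp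
  moreover have "(\<lambda>f. Tword v (Tword (rev v) f)) = oneW"
    using Tword_append[of "rev v" v] Tword_cancel_rev[of "rev v"] v by simp
  ultimately show ?thesis using v Tword_bounded by (simp add: Tword_star oneW_eq)
qed

lemma rep_hom: "rep \<in> hom (racg S m) (unitary_group W)"
proof (rule homI)
  fix x assume "x \<in> W"
  then obtain v where "v \<in> lists S" "x = cls v" by (rule carrier_cases)
  then show "rep x \<in> carrier (unitary_group W)"
    using Tword_unitary rep_cls by (simp del: unitary_simps)
next
  fix x y assume "x \<in> W" "y \<in> W"
  then obtain u v where "u \<in> lists S" "v \<in> lists S" "x = cls u" "y = cls v"
    by (auto simp: carrier_racg)
  then show "rep (x \<otimes>\<^bsub>racg S m\<^esub> y) = rep x \<otimes>\<^bsub>unitary_group W\<^esub> rep y"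
    by (simp add: racg_mult rep_cls Tword_append)
qed

lemma is_hecke_rep_iff:
  "is_hecke_rep S m q \<pi> \<longleftrightarrow> \<pi> \<in> hom (racg S m) (unitary_group W) \<and> \<pi> \<in> extensional W \<and>
     (\<forall>s\<in>S. \<forall>w\<in>W. \<pi> (cls [s]) (delta w) = T s (delta w))"
proof -
  have "word_length (lmult s w) < word_length w \<longleftrightarrow> \<not> up s w"
    "word_length w < word_length (lmult s w) \<longleftrightarrow> up s w" if "s \<in> S" "w \<in> W" for s w
    using not_up that by (auto simp: up_def)
  then show ?thesis
    unfolding is_hecke_rep_def Let_def lmult_def[symmetric] racg_gen_cls[symmetric]
    by (auto simp: T_delta diag_coeff_def hecke_c_def hecke_d_def)
qed

lemma is_hecke_rep_rep: "is_hecke_rep S m q rep"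
  unfolding is_hecke_rep_iff using rep_hom by (auto simp: rep_cls Tword_single) (simp add: rep_def)

text \<open>The values at the generators are bounded operators prescribed on the basis vectors, and the generators
generate the group. The value at the unit is obtained from \<open>e = ss\<close>, which uses that \<open>S\<close> is non-empty.\<close>

lemma hecke_unique: assumes "is_hecke_rep S m q \<pi>" shows "\<pi> = rep"
proof
  have hom: "\<pi> \<in> hom (racg S m) (unitary_group W)" and ext: "\<pi> \<in> extensional W"
    and d: "\<And>s w. s \<in> S \<Longrightarrow> w \<in> W \<Longrightarrow> \<pi> (cls [s]) (delta w) = T s (delta w)"
    using assms by (auto simp: is_hecke_rep_iff)
  have gen: "\<pi> (cls [s]) = T s" if s: "s \<in> S" for s
  proof -
    have "\<pi> (cls [s]) \<in> carrier (unitary_group W)" by (rule hom_in_carrier[OF hom]) (use s in simp)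
    then show ?thesis using s d by (intro bounded_op_eqI[of W]) auto
  qed
  have mult: "\<pi> (cls (u @ v)) = (\<lambda>f. \<pi> (cls u) (\<pi> (cls v) f))" if "u \<in> lists S" "v \<in> lists S" for u v
    using hom_mult[OF hom, of "cls u" "cls v"] that by (simp add: racg_mult)
  have main: "\<pi> (cls v) = Tword v" if "v \<in> lists S" for v
    using that
  proof (induction v)
    case Nil
    obtain s where s: "s \<in> S" using neS by blast
    have "cls [s, s] = cls []" using lmult_lmult[of s "cls []"] s by (simp add: lmult_cls)
    then have "\<pi> (cls []) = (\<lambda>f. T s (T s f))" using mult[of "[s]" "[s]"] s gen by simp
    also have "\<dots> = Tword [s, s]" using s Tword_append[of "[s]" "[s]"] by (simp add: Tword_single)
    also have "\<dots> = Tword []" using s Tword_square by simp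
    finally show ?case .
  next
    case (Cons s v)
    then show ?case using mult[of "[s]" v] gen by (simp add: Tword_Cons)
  qed
  fix w show "\<pi> w = rep w"
  proof (cases "w \<in> W")
    case True
    then obtain v where "v \<in> lists S" "w = cls v" by (rule carrier_cases)
    then show ?thesis using main rep_cls by simp
  next
    case False
    then show ?thesis using ext by (simp add: extensional_def rep_def)
  qed
qed

lemma hecke_rep_eq: "hecke_rep S m q = rep"
  unfolding hecke_rep_def using is_hecke_rep_rep hecke_unique by (rule the_equality)

section \<open>The Hecke C*-algebra\<close>

abbreviation "A \<equiv> hecke_cstar S m q"

lemma A_simps [simp]:
  "mult A = (\<lambda>T U f. T (U f))" "one A = oneW" "zero A = (\<lambda>f i. 0)"
  "add A = (\<lambda>T U f i. T f i + U f i)" "star A = op_adjoint W"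
  by (simp_all add: hecke_cstar_def cstar_generated_def bounded_ops_def oneW_eq)

lemma carrier_A: "carrier A = \<Inter>{B. is_cstar_subalgebra W B \<and> Tword ` lists S \<subseteq> B}"
proof -
  have "rep ` W = Tword ` lists S"
    by (auto simp: carrier_racg rep_cls image_image cong: image_cong)
  then show ?thesis by (simp add: hecke_cstar_def cstar_generated_def hecke_rep_eq)
qed

text \<open>Induction over the generated C*-algebra.\<close>

lemma A_subset: "is_cstar_subalgebra W B \<Longrightarrow> (\<And>v. v \<in> lists S \<Longrightarrow> Tword v \<in> B) \<Longrightarrow> carrier A \<subseteq> B"
  unfolding carrier_A by blast

lemma A_bounded: "x \<in> carrier A \<Longrightarrow> bounded_op W x"
  using A_subset[OF is_cstar_all] Tword_bounded by blast

lemma A_Tword: "v \<in> lists S \<Longrightarrow> Tword v \<in> carrier A"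
  unfolding carrier_A by blast

lemma A_zero: "(\<lambda>f i. 0) \<in> carrier A"
  and A_add: "x \<in> carrier A \<Longrightarrow> y \<in> carrier A \<Longrightarrow> (\<lambda>f i. x f i + y f i) \<in> carrier A"
  and A_mult: "x \<in> carrier A \<Longrightarrow> y \<in> carrier A \<Longrightarrow> (\<lambda>f. x (y f)) \<in> carrier A"
  and A_scale: "x \<in> carrier A \<Longrightarrow> op_scale c x \<in> carrier A"
  and A_star: "x \<in> carrier A \<Longrightarrow> op_adjoint W x \<in> carrier A"
  unfolding carrier_A is_cstar_iff by blast+

lemma A_one: "oneW \<in> carrier A"
  using A_Tword[of "[]"] by (simp add: Tword_Nil)

section \<open>Traciality\<close>

text \<open>The bounded operators that commute with every \<open>R t\<close>.\<close>

definition right_commutant :: "'a word set operator set" where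
  "right_commutant = {x. bounded_op W x \<and> (\<forall>t\<in>S. \<forall>f\<in>ell2 W. x (R t f) = R t (x f))}"

lemma R_add: "t \<in> S \<Longrightarrow> f \<in> ell2 W \<Longrightarrow> g \<in> ell2 W \<Longrightarrow> R t (\<lambda>i. f i + g i) = (\<lambda>i. R t f i + R t g i)"
  by (rule bounded_opD(3)[OF R_bounded])

lemma right_commutant_cstar: "is_cstar_subalgebra W right_commutant"
  unfolding is_cstar_iff
proof (intro conjI allI ballI impI)
  show "(\<lambda>f i. 0) \<in> right_commutant"
    using bounded_op_zero[OF R_bounded] by (simp add: right_commutant_def bounded_op_zero_op)
  fix x assume x: "x \<in> right_commutant"
  then show xb: "bounded_op W x" by (simp add: right_commutant_def)
  show "op_scale c x \<in> right_commutant" for c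
    using x bounded_opD(4)[OF R_bounded bounded_op_closed[OF xb]] by (auto simp: right_commutant_def bounded_op_scale) (simp add: op_scale_def)
  fix y assume y: "y \<in> right_commutant"
  then have yb: "bounded_op W y" by (simp add: right_commutant_def)
  show "(\<lambda>f i. x f i + y f i) \<in> right_commutant"
    using x y R_add[OF _ bounded_op_closed[OF xb] bounded_op_closed[OF yb]] bounded_op_add[OF xb yb] by (auto simp: right_commutant_def)
  show "(\<lambda>f. x (y f)) \<in> right_commutant"
    using x y bounded_op_mult[OF xb yb] by (auto simp: right_commutant_def)
next
  fix x assume x: "x \<in> right_commutant"
  then have xb: "bounded_op W x" by (simp add: right_commutant_def)
  let ?y = "op_adjoint W x"
  note y = op_adjoint[OF xb]
  have "?y (R t f) = R t (?y f)" if t: "t \<in> S" and f: "f \<in> ell2 W" for t f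
  proof (rule ell2_inner_eqI)
    show "?y (R t f) \<in> ell2 W" "R t (?y f) \<in> ell2 W" using t y by simp_all
    fix h assume h: "h \<in> ell2 W"
    have "ell2_inner W h (?y (R t f)) = ell2_inner W (x h) (R t f)"
      using is_adjointD[OF y(2) h] t by simp
    also have "\<dots> = ell2_inner W (R t (x h)) f" using is_adjointD[OF R_adj[OF t]] f xb by simp
    also have "\<dots> = ell2_inner W (x (R t h)) f" using x t h by (simp add: right_commutant_def)
    also have "\<dots> = ell2_inner W (R t h) (?y f)" using is_adjointD[OF y(2)] t f by simp
    also have "\<dots> = ell2_inner W h (R t (?y f))" using is_adjointD[OF R_adj[OF t]] h y by simp
    finally show "ell2_inner W h (?y (R t f)) = ell2_inner W h (R t (?y f))" .
  qed
  then show "?y \<in> right_commutant" using y by (simp add: right_commutant_def)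
next
  fix X x assume X: "\<forall>n::nat. X n \<in> right_commutant" and xb: "bounded_op W x"
    and lim: "(\<lambda>n. op_norm W (\<lambda>f i. X n f i + op_scale (- 1) x f i)) \<longlonglongrightarrow> 0"
  have Xb: "bounded_op W (X n)" for n using X by (simp add: right_commutant_def)
  have l: "(\<lambda>n. X n f i) \<longlonglongrightarrow> x f i" for f i by (rule op_norm_limit_coord[OF Xb xb lim])
  have "x (R t f) = R t (x f)" if t: "t \<in> S" and f: "f \<in> ell2 W" for t f
  proof (rule ell2_eqI[where I = W])
    show "x (R t f) \<in> ell2 W" "R t (x f) \<in> ell2 W" using t xb by simp_all
    fix w assume w: "w \<in> W"
    have "(\<lambda>n. R t (X n f) w) \<longlonglongrightarrow> R t (x f) w"
      unfolding R_apply[OF bounded_op_closed[OF Xb] w] R_apply[OF bounded_op_closed[OF xb] w]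
      by (intro tendsto_intros l)
    moreover have "R t (X n f) = X n (R t f)" for n using X t f by (simp add: right_commutant_def)
    ultimately have "(\<lambda>n. X n (R t f) w) \<longlonglongrightarrow> R t (x f) w" by simp
    then show "x (R t f) w = R t (x f) w" using l LIMSEQ_unique by blast
  qed
  then show "x \<in> right_commutant" using xb by (simp add: right_commutant_def)
qed

lemma Tword_right_commutant: "v \<in> lists S \<Longrightarrow> Tword v \<in> right_commutant"
proof (induction v)
  case Nil
  show ?case using Tword_bounded[of "[]"] by (simp add: right_commutant_def Tword_Nil)
next
  case (Cons s v)
  then show ?case using Tword_bounded[of "s # v"] Tword_bounded[of v] by (simp add: right_commutant_def Tword_Cons T_R)
qed

lemma A_right_commutant: "carrier A \<subseteq> right_commutant"
  by (intro A_subset right_commutant_cstar Tword_right_commutant)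

lemma up_winv_snoc: assumes "reduced (v @ [t])" shows "up t (winv (cls v))"
proof -
  have l: "v \<in> lists S" "t \<in> S" using reduced_lists[OF assms] by auto
  have "reduced v" using reduced_rev[OF reduced_tl[of "[t]" "rev v"]] reduced_rev[OF assms] by simp
  moreover have "word_length (lmult t (winv (cls v))) = word_length (cls (v @ [t]))"
    by (simp add: rmult_cls[OF l(2,1), symmetric] rmult_def)
  ultimately show ?thesis
    using word_length_reduced[OF assms] word_length_reduced[of v] by (simp add: up_def)
qed

text \<open>Moving the letters of \<open>u\<close> one by one from the argument to the point of evaluation: if \<open>t\<close> lengthens
\<open>w\<close> from the right, then \<open>(R t - c) / d\<close> maps \<open>\<delta>\<^sub>w\<close> to \<open>\<delta>\<close> at \<open>wt\<close>, and the value of \<open>(R t - c) / d\<close>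
applied to a vector at \<open>w\<close> is its value at \<open>wt\<close>. Reducedness of \<open>v @ rev u\<close> guarantees that every
step lengthens.\<close>

lemma right_commutant_shift:
  assumes x: "x \<in> right_commutant"
  shows "reduced (v @ rev u) \<Longrightarrow> x (delta (cls u)) (cls v) = x (delta (cls [])) (cls (v @ rev u))"
proof (induction u arbitrary: v rule: rev_induct)
  case (snoc t u)
  let ?c = "complex_of_real (hecke_c t)" and ?d = "complex_of_real (hecke_d t)"
  have r: "reduced ((v @ [t]) @ rev u)" using snoc by simp
  have l: "v \<in> lists S" "t \<in> S" "u \<in> lists S" using reduced_lists[OF r] by auto
  have "reduced (v @ [t])" using reduced_rev[OF reduced_tl[of "u" "t # rev v"]] reduced_rev[OF r] by simp
  then have uv: "up t (winv (cls v))" by (rule up_winv_snoc)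
  have "reduced (u @ [t])" using reduced_rev[OF reduced_tl[of v "t # rev u"]] r by simp
  then have uu: "up t (winv (cls u))" by (rule up_winv_snoc)
  have xb: "bounded_op W x" using x by (simp add: right_commutant_def)
  have du: "delta (cls u) \<in> ell2 W" "delta (cls (u @ [t])) \<in> ell2 W" using l by (simp_all add: delta_ell2)
  have "R t (delta (cls u)) = (\<lambda>i. ?c * delta (cls u) i + ?d * delta (cls (u @ [t])) i)"
    using R_delta[of t "cls u"] l uu by (simp add: diag_coeff_def rmult_cls)
  then have "x (R t (delta (cls u))) = (\<lambda>i. ?c * x (delta (cls u)) i + ?d * x (delta (cls (u @ [t]))) i)"
    using xb du by (simp add: bounded_opD(3)[OF xb] bounded_opD(4)[OF xb] ell2_scale_le)
  then have "?c * x (delta (cls u)) (cls v) + ?d * x (delta (cls (u @ [t]))) (cls v)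
      = R t (x (delta (cls u))) (cls v)"
    using x l du by (simp add: right_commutant_def fun_eq_iff)
  also have "\<dots> = ?c * x (delta (cls u)) (cls v) + ?d * x (delta (cls u)) (cls (v @ [t]))"
    using R_apply[OF bounded_op_closed[OF xb]] l uv by (simp add: diag_coeff_def rmult_cls)
  finally have "x (delta (cls (u @ [t]))) (cls v) = x (delta (cls u)) (cls (v @ [t]))"
    using hecke_d_nz[OF l(2)] by simp
  then show ?case using snoc.IH[OF r] by simp
qed simp

lemma right_commutant_winv: assumes "x \<in> right_commutant" "w \<in> W" shows "x (delta w) (cls []) = x (delta (cls [])) (winv w)"
proof -
  obtain u where "reduced u" "w = cls u" using assms(2) by (rule carrier_reduced)
  then show ?thesis using right_commutant_shift[OF assms(1), of "[]" u] reduced_rev by (simp add: winv_cls)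
qed

text \<open>The natural trace, with the inner product evaluated.\<close>

definition tr :: "'a word set operator \<Rightarrow> complex" where
  "tr x = x (delta (cls [])) (cls [])"

lemma natural_trace_eq: "natural_trace S m x = tr x"
  by (simp add: natural_trace_def racg_one ell2_inner_delta tr_def)

lemma tr_mult:
  assumes x: "x \<in> right_commutant" and y: "y \<in> right_commutant"
  shows "tr (\<lambda>f. x (y f)) = (\<Sum>\<^sub>\<infinity>w\<in>W. y (delta (cls [])) w * x (delta (cls [])) (winv w))"
proof -
  have b: "bounded_op W x" "bounded_op W y" using x y by (auto simp: right_commutant_def)
  have e: "cls [] \<in> W" by simp
  have "tr (\<lambda>f. x (y f)) = (\<Sum>\<^sub>\<infinity>w\<in>W. y (delta (cls [])) w * x (delta w) (cls []))"
    using bounded_op_inner_has_sum[OF b(1) bounded_op_closed[OF b(2)] delta_ell2[OF e], of "delta (cls [])"]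
    by (simp add: tr_def ell2_inner_delta infsumI)
  also have "\<dots> = (\<Sum>\<^sub>\<infinity>w\<in>W. y (delta (cls [])) w * x (delta (cls [])) (winv w))"
    using right_commutant_winv[OF x] by (intro infsum_cong) simp
  finally show ?thesis .
qed

lemma tr_commute:
  assumes x: "x \<in> right_commutant" and y: "y \<in> right_commutant"
  shows "tr (\<lambda>f. x (y f)) = tr (\<lambda>f. y (x f))"
proof -
  have bij: "bij_betw winv W W" using winv_carrier by (intro bij_betw_byWitness[where f' = winv]) auto
  show ?thesis
    unfolding tr_mult[OF x y] tr_mult[OF y x]
    using infsum_reindex_bij_betw[OF bij, of "\<lambda>w. y (delta (cls [])) w * x (delta (cls [])) (winv w)"]
    by (simp add: mult.commute)
qed

section \<open>Clique projections\<close>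

abbreviation "chi \<equiv> chi1 S m q"

lemma chi_eq: assumes s: "s \<in> S" shows "chi s = op_scale (1/2) (\<lambda>f i. oneW f i + T s f i)"
  using s by (simp add: chi1_def hecke_rep_eq racg_gen_cls rep_cls Tword_single)

lemma chi_apply: "s \<in> S \<Longrightarrow> f \<in> ell2 W \<Longrightarrow> chi s f = (\<lambda>i. 1/2 * (f i + T s f i))"
  by (simp add: chi_eq op_scale_def)

lemma chi_A: assumes s: "s \<in> S" shows "chi s \<in> carrier A"
  unfolding chi_eq[OF s] using A_Tword[of "[s]"] s by (intro A_scale A_add A_one) (simp add: Tword_single)

lemma chi_bounded: "s \<in> S \<Longrightarrow> bounded_op W (chi s)"
  using chi_A A_bounded by blast

lemma T_lin:
  assumes s: "s \<in> S" and f: "f \<in> ell2 W" and g: "g \<in> ell2 W"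
  shows "T s (\<lambda>i. c * (f i + g i)) = (\<lambda>i. c * (T s f i + T s g i))"
  using bounded_opD(3)[OF T_bounded[OF s] f g] bounded_opD(4)[OF T_bounded[OF s] ell2_add(1)[OF f g], of c]
  by simp

lemma chi_adj: assumes s: "s \<in> S" shows "is_adjoint W (chi s) (chi s)"
proof -
  have o: "bounded_op W oneW" using bounded_op_one[of W] by (simp add: oneW_eq)
  have "is_adjoint W oneW oneW" using adjoint_one[of W] by (simp add: oneW_eq)
  then have "is_adjoint W (\<lambda>f i. oneW f i + T s f i) (\<lambda>f i. oneW f i + T s f i)"
    using s o by (intro adjoint_add T_adj) simp_all
  from adjoint_scale[OF this, of "1/2"] show ?thesis by (simp add: chi_eq[OF s])
qed

lemma chi_idem: assumes s: "s \<in> S" and f: "f \<in> ell2 W" shows "chi s (chi s f) = chi s f"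
proof -
  have Tf: "T s f \<in> ell2 W" using s by simp
  have Tc: "T s (chi s f) = (\<lambda>i. 1/2 * (T s f i + f i))"
    using T_lin[OF s f Tf, of "1/2"] T_T[OF s f] chi_apply[OF s f] by simp
  have 1: "chi s (chi s f) = (\<lambda>i. 1/2 * (chi s f i + T s (chi s f) i))"
    by (rule chi_apply[OF s bounded_op_closed[OF chi_bounded[OF s]]])
  show ?thesis by (simp only: 1 Tc) (simp add: chi_apply[OF s f] fun_eq_iff field_simps)
qed

lemma chi_commuting: assumes c: "commuting s t" and f: "f \<in> ell2 W" shows "chi s (chi t f) = chi t (chi s f)"
proof -
  have s: "s \<in> S" and t: "t \<in> S" using c by (auto simp: commuting_def)
  have Tf: "T s f \<in> ell2 W" "T t f \<in> ell2 W" using s t by simp_all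
  have Tc: "T s (chi t f) = (\<lambda>i. 1/2 * (T s f i + T s (T t f) i))"
    "T t (chi s f) = (\<lambda>i. 1/2 * (T t f i + T t (T s f) i))"
    using T_lin[OF s f Tf(2), of "1/2"] T_lin[OF t f Tf(1), of "1/2"] chi_apply[OF s f] chi_apply[OF t f] by simp_all
  have 1: "chi s (chi t f) = (\<lambda>i. 1/2 * (chi t f i + T s (chi t f) i))"
    "chi t (chi s f) = (\<lambda>i. 1/2 * (chi s f i + T t (chi s f) i))"
    by (rule chi_apply[OF s bounded_op_closed[OF chi_bounded[OF t]]],
        rule chi_apply[OF t bounded_op_closed[OF chi_bounded[OF s]]])
  show ?thesis by (simp only: 1 Tc)
    (simp add: chi_apply[OF s f] chi_apply[OF t f] T_commuting[OF c f] fun_eq_iff field_simps)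
qed

lemma cliques_commuting: "C \<in> cliques S m \<Longrightarrow> s \<in> C \<Longrightarrow> t \<in> C \<Longrightarrow> s \<noteq> t \<Longrightarrow> commuting s t"
  by (auto simp: cliques_def commutation_edge_def commuting_def)

lemma cliques_subset: "C \<in> cliques S m \<Longrightarrow> C \<subseteq> S"
  by (simp add: cliques_def)

lemma clique_proj_empty: "clique_proj S m q {} = oneW"
proof -
  interpret LCD "{} :: 'a set" "carrier A" "mult A \<circ> chi" by unfold_locales auto
  show ?thesis using A_one by (simp add: clique_proj_def finprod_def del: A_simps) simp
qed

text \<open>Over a clique the factors commute, so \<open>finprod\<close> is the product although the algebra is not commutative.\<close>

lemma clique_proj_insert:
  assumes C: "C \<in> cliques S m" and F: "F \<subseteq> C" "s \<in> C" "s \<notin> F"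
  shows "clique_proj S m q (insert s F) = (\<lambda>f. chi s (clique_proj S m q F f))"
proof -
  have C': "\<And>s. s \<in> C \<Longrightarrow> s \<in> S" using cliques_subset[OF C] by blast
  interpret LCD C "carrier A" "mult A \<circ> chi"
  proof
    fix x y z assume x: "x \<in> C" and y: "y \<in> C" and z: "z \<in> carrier A"
    have "chi x (chi y (z f)) = chi y (chi x (z f))" for f
      using chi_commuting cliques_commuting[OF C x y] bounded_op_closed[OF A_bounded[OF z]] by (cases "x = y") auto
    then show "(mult A \<circ> chi) x ((mult A \<circ> chi) y z) = (mult A \<circ> chi) y ((mult A \<circ> chi) x z)" by simp
  next
    fix x y assume "x \<in> C" "y \<in> carrier A"
    then show "(mult A \<circ> chi) x y \<in> carrier A" using A_mult[OF chi_A[OF C']] by simp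
  qed
  have fin: "finite F" using F(1) cliques_subset[OF C] finS by (metis finite_subset)
  show ?thesis
    using foldD_insert[OF fin F(3,2) _ F(1), of "one A"] A_one fin
    by (simp add: clique_proj_def finprod_def)
qed

text \<open>The fifth conclusion says that \<open>p \<delta>\<^sub>e\<close> vanishes at every element whose \<open>(t, t)\<close>-stack is non-empty
for some \<open>t \<in> S - F\<close>: operators \<open>chi s\<close> with \<open>s \<noteq> t\<close> do not change this stack. It yields the value of
the trace in the induction step.\<close>

lemma clique_proj_props:
  assumes C: "C \<in> cliques S m" and F: "F \<subseteq> C"
  defines "p \<equiv> clique_proj S m q F"
  shows "p \<in> carrier A" "is_adjoint W p p" "\<forall>f. p (p f) = p f"
    "\<forall>t\<in>C. \<forall>f\<in>ell2 W. p (chi t f) = chi t (p f)"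
    "\<forall>t\<in>S - F. \<forall>v\<in>lists S. piles v t t \<noteq> [] \<longrightarrow> p (delta (cls [])) (cls v) = 0"
    "tr p = of_real (\<Prod>s\<in>F. 1 / (1 + q s))"
proof -
  have C': "\<And>s. s \<in> C \<Longrightarrow> s \<in> S" using cliques_subset[OF C] by blast
  have fin: "finite F" using F cliques_subset[OF C] finS by (metis finite_subset)
  have "p \<in> carrier A \<and> is_adjoint W p p \<and> (\<forall>f. p (p f) = p f) \<and>
    (\<forall>t\<in>C. \<forall>f\<in>ell2 W. p (chi t f) = chi t (p f)) \<and>
    (\<forall>t\<in>S - F. \<forall>v\<in>lists S. piles v t t \<noteq> [] \<longrightarrow> p (delta (cls [])) (cls v) = 0) \<and>
    tr p = of_real (\<Prod>s\<in>F. 1 / (1 + q s))"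
    unfolding p_def using fin F
  proof (induction F)
    case empty
    have e: "delta (cls []) \<in> ell2 W" by (simp add: delta_ell2)
    have "delta (cls []) (cls v) = 0" if "v \<in> lists S" "piles v t t \<noteq> []" for v t
      using cls_piles[of v "[]"] that by (auto simp: delta_def)
    moreover have "chi t f \<in> ell2 W" if "t \<in> C" for t f using chi_bounded[OF C'[OF that]] by simp
    moreover have "is_adjoint W oneW oneW" using adjoint_one[of W] by (simp add: oneW_eq)
    ultimately show ?case using A_one e by (simp add: clique_proj_empty tr_def) (simp add: delta_def)
  next
    case (insert s F)
    let ?p = "clique_proj S m q F"
    have sC: "s \<in> C" and FC: "F \<subseteq> C" using insert.prems by auto
    have s: "s \<in> S" using sC C' by blast
    have IH: "?p \<in> carrier A" "is_adjoint W ?p ?p" "\<And>f. ?p (?p f) = ?p f"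
      "\<And>t f. t \<in> C \<Longrightarrow> f \<in> ell2 W \<Longrightarrow> ?p (chi t f) = chi t (?p f)"
      "\<And>t v. t \<in> S - F \<Longrightarrow> v \<in> lists S \<Longrightarrow> piles v t t \<noteq> [] \<Longrightarrow> ?p (delta (cls [])) (cls v) = 0"
      "tr ?p = of_real (\<Prod>s\<in>F. 1 / (1 + q s))"
      using insert.IH[OF FC] by blast+
    have pb: "bounded_op W ?p" using IH(1) A_bounded by blast
    note pin = bounded_op_closed[OF pb] 
    note cin = bounded_op_closed[OF chi_bounded[OF s]]
    have eq: "clique_proj S m q (insert s F) = (\<lambda>f. chi s (?p f))"
      using clique_proj_insert[OF C FC sC] insert.hyps by blast
    let ?g = "?p (delta (cls []))"
    have val: "chi s ?g (cls v) = 1/2 * (?g (cls v) + (of_real (diag_coeff s (cls v)) * ?g (cls v)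
         + of_real (hecke_d s) * ?g (cls (s # v))))" if "v \<in> lists S" for v
      using chi_apply[OF s pin] T_apply[OF pin] that s by (simp add: lmult_cls)
    have 1: "(\<lambda>f. chi s (?p f)) \<in> carrier A" using A_mult[OF chi_A[OF s] IH(1)] .
    have 2: "is_adjoint W (\<lambda>f. chi s (?p f)) (\<lambda>f. chi s (?p f))"
    proof -
      have "is_adjoint W (\<lambda>f. chi s (?p f)) (\<lambda>f. ?p (chi s f))"
        by (rule adjoint_mult[OF chi_bounded[OF s] pb chi_bounded[OF s] chi_adj[OF s] IH(2)])
      then show ?thesis using IH(4)[OF sC] by (simp add: is_adjoint_def)
    qed
    have 3: "chi s (?p (chi s (?p f))) = chi s (?p f)" for f
      using IH(4)[OF sC pin] IH(3) chi_idem[OF s pin] by simp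
    have 4: "chi s (?p (chi t f)) = chi t (chi s (?p f))" if "t \<in> C" "f \<in> ell2 W" for t f
      using IH(4)[OF that] chi_commuting[OF cliques_commuting[OF C sC that(1)] pin] by (cases "s = t") auto
    have 5: "chi s ?g (cls v) = 0" if t: "t \<in> S - insert s F" and v: "v \<in> lists S" "piles v t t \<noteq> []" for t v
    proof -
      have "\<not> touched s t t" using t by (auto simp: touched_def)
      then have "piles (s # v) t t \<noteq> []" using v by (simp add: act_def push_def pop_def)
      then show ?thesis using val[OF v(1)] IH(5)[of t v] IH(5)[of t "s # v"] t v s by simp
    qed
    have 6: "tr (\<lambda>f. chi s (?p f)) = of_real (\<Prod>s\<in>insert s F. 1 / (1 + q s))"
    proof -
      have nd: "\<not> descent s (piles [])" using touched_self[OF s] by (auto simp: descent_def)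
      then have "up s (cls [])" using s by (simp add: up_cls)
      moreover have "piles [s] s s \<noteq> []" using nd touched_self[OF s] by (simp add: act_def push_def)
      then have "?g (cls [s]) = 0" using IH(5)[of s "[s]"] s insert.hyps by simp
      ultimately have "chi s ?g (cls []) = of_real ((1 + hecke_c s) / 2) * ?g (cls [])"
        using val[of "[]"] by (simp add: diag_coeff_def field_simps)
      moreover have "(1 + hecke_c s) / 2 = 1 / (1 + q s)" using q[OF s] by (simp add: hecke_c_def field_simps)
      ultimately show ?thesis using IH(6) insert.hyps by (simp add: tr_def)
    qed
    show ?case unfolding eq using 1 2 3 4 5 6 by blast
  qed
  then show "p \<in> carrier A" "is_adjoint W p p" "\<forall>f. p (p f) = p f"
    "\<forall>t\<in>C. \<forall>f\<in>ell2 W. p (chi t f) = chi t (p f)"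
    "\<forall>t\<in>S - F. \<forall>v\<in>lists S. piles v t t \<noteq> [] \<longrightarrow> p (delta (cls [])) (cls v) = 0"
    "tr p = of_real (\<Prod>s\<in>F. 1 / (1 + q s))" by blast+
qed

section \<open>The trace on projections and on \<open>K\<^sub>0\<close>\<close>

lemma A_monoid: "abelian_monoid A"
  by (rule abelian_monoidI) (auto simp: A_zero A_add fun_eq_iff algebra_simps)

lemma tr_finsum:
  assumes "finite K" "\<And>k. k \<in> K \<Longrightarrow> x k \<in> carrier A"
  shows "tr (finsum A x K) = (\<Sum>k\<in>K. tr (x k))"
  using assms
proof (induction K)
  case empty
  then show ?case using abelian_monoid.finsum_empty[OF A_monoid, of x] by (simp add: tr_def)
next
  case (insert k K)
  then have "finsum A x (insert k K) = x k \<oplus>\<^bsub>A\<^esub> finsum A x K"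
    by (intro abelian_monoid.finsum_insert[OF A_monoid]) auto
  then show ?case using insert by (simp add: tr_def)
qed

lemma tr_commute_A: "x \<in> carrier A \<Longrightarrow> y \<in> carrier A \<Longrightarrow> tr (x \<otimes>\<^bsub>A\<^esub> y) = tr (y \<otimes>\<^bsub>A\<^esub> x)"
  using tr_commute A_right_commutant by auto

lemma mvn_trace:
  assumes "mvn_equiv A P Q"
  shows "mat_trace tr P = mat_trace tr Q"
proof -
  obtain v where v: "v \<in> mats A (fst Q) (fst P)"
    "mats_mult A (fst Q) (mats_star A v) v = snd P"
    "mats_mult A (fst P) v (mats_star A v) = snd Q"
    using assms by (auto simp: mvn_equiv_def)
  let ?n = "fst Q" and ?m = "fst P"
  have vA: "v k i \<in> carrier A" "star A (v k i) \<in> carrier A" if "k < ?n" "i < ?m" for k i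
    using v(1) that A_star by (auto simp: mats_def)
  have cl: "x \<otimes>\<^bsub>A\<^esub> y \<in> carrier A" if "x \<in> carrier A" "y \<in> carrier A" for x y
    using A_mult that by simp
  have "mat_trace tr P = (\<Sum>i<?m. tr (finsum A (\<lambda>k. star A (v k i) \<otimes>\<^bsub>A\<^esub> v k i) {..<?n}))"
    unfolding mat_trace_def v(2)[symmetric] by (simp add: mats_mult_def mats_star_def del: A_simps)
  also have "\<dots> = (\<Sum>i<?m. \<Sum>k<?n. tr (star A (v k i) \<otimes>\<^bsub>A\<^esub> v k i))"
    using vA cl by (intro sum.cong tr_finsum) auto
  also have "\<dots> = (\<Sum>i<?m. \<Sum>k<?n. tr (v k i \<otimes>\<^bsub>A\<^esub> star A (v k i)))"
    using vA by (intro sum.cong tr_commute_A) auto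
  also have "\<dots> = (\<Sum>k<?n. \<Sum>i<?m. tr (v k i \<otimes>\<^bsub>A\<^esub> star A (v k i)))" by (rule sum.swap)
  also have "\<dots> = (\<Sum>k<?n. tr (finsum A (\<lambda>i. v k i \<otimes>\<^bsub>A\<^esub> star A (v k i)) {..<?m}))"
    using vA cl by (intro sum.cong tr_finsum[symmetric]) auto
  also have "\<dots> = mat_trace tr Q"
    unfolding mat_trace_def v(3)[symmetric] by (simp add: mats_mult_def mats_star_def del: A_simps)
  finally show ?thesis .
qed

lemma trace_diag_sum: "mat_trace \<tau> (diag_sum A P Q) = mat_trace \<tau> P + mat_trace \<tau> Q"
proof -
  have split: "(\<Sum>i<k + l. f i) = (\<Sum>i<k. f i) + (\<Sum>i<l. f (k + i))" for k l :: nat and f :: "nat \<Rightarrow> complex"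
    by (induction l) (simp_all add: add.assoc)
  show ?thesis by (simp add: mat_trace_def diag_sum_def split)
qed

lemma mat1_proj:
  assumes "p \<in> carrier A" "is_adjoint W p p" "\<forall>f. p (p f) = p f"
  shows "mat1 A p \<in> proj_mats A"
proof -
  have pb: "bounded_op W p" using assms A_bounded by blast
  have "op_adjoint W p = p" by (rule op_adjoint_eqI[OF pb assms(2)])
  then have s: "mats_star A (snd (mat1 A p)) = snd (mat1 A p)"
    by (auto simp: mats_star_def mat1_def fun_eq_iff adjoint_zero)
  have "mats_mult A 1 (snd (mat1 A p)) (snd (mat1 A p)) i j = snd (mat1 A p) i j" for i j
  proof -
    let ?x = "\<lambda>k. snd (mat1 A p) i k \<otimes>\<^bsub>A\<^esub> snd (mat1 A p) k j"
    have x: "?x 0 = snd (mat1 A p) i j"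
      using assms(3) bounded_op_zero[OF pb] by (auto simp: mat1_def)
    have c: "snd (mat1 A p) i j \<in> carrier A" using assms(1) A_zero by (simp add: mat1_def)
    have "finsum A ?x (insert 0 {}) = ?x 0 \<oplus>\<^bsub>A\<^esub> finsum A ?x {}"
      using x c by (intro abelian_monoid.finsum_insert[OF A_monoid]) (auto simp del: A_simps)
    also have "\<dots> = ?x 0 \<oplus>\<^bsub>A\<^esub> \<zero>\<^bsub>A\<^esub>" by (simp only: abelian_monoid.finsum_empty[OF A_monoid])
    also have "\<dots> = snd (mat1 A p) i j" unfolding x by simp
    finally show ?thesis by (simp add: mats_mult_def lessThan_Suc del: A_simps)
  qed
  then show ?thesis using s assms(1) by (auto simp: proj_mats_def mat1_def mats_def)
qed

lemma diag_sum_zero: "P \<in> proj_mats A \<Longrightarrow> diag_sum A P (zero_proj A) = P"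
  by (cases P) (auto simp: diag_sum_def zero_proj_def proj_mats_def mats_def fun_eq_iff)

lemma zero_proj: "zero_proj A \<in> proj_mats A"
  by (simp add: zero_proj_def proj_mats_def mats_def mats_star_def mats_mult_def adjoint_zero fun_eq_iff
      abelian_monoid.finsum_empty[OF A_monoid] del: A_simps) (simp add: adjoint_zero)

lemma trace_zero_proj: "mat_trace \<tau> (zero_proj A) = 0"
  by (simp add: mat_trace_def zero_proj_def)

lemma mvn_refl: "P \<in> proj_mats A \<Longrightarrow> mvn_equiv A P P"
  unfolding mvn_equiv_def by (intro bexI[of _ "snd P"]) (auto simp: proj_mats_def)

text \<open>\<open>\<tau>\<close> takes the same value on all representatives of the class, so the description defining
\<open>K0_trace\<close> has exactly one solution.\<close>

lemma K0_trace_class: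
  assumes P: "P \<in> proj_mats A" and r: "mat_trace tr P = of_real r"
  shows "K0_trace A tr (K0_class A P) = r"
proof -
  let ?x = "K0_diff A (P, zero_proj A)"
  have "?x \<in> carrier (K0 A)" using P zero_proj by (simp add: K0_def)
  moreover have in_x: "(P, zero_proj A) \<in> ?x"
    using P zero_proj mvn_refl[OF P]
    by (auto simp: K0_diff_def diag_sum_zero intro!: bexI[of _ "zero_proj A"])
  have all_x: "mat_trace tr P' - mat_trace tr Q' = of_real r" if "(P', Q') \<in> ?x" for P' Q'
  proof -
    have "\<exists>R\<in>proj_mats A. mvn_equiv A (diag_sum A (diag_sum A P Q') R)
        (diag_sum A (diag_sum A P' (zero_proj A)) R)"
      using that by (simp add: K0_diff_def)
    then obtain R where "mvn_equiv A (diag_sum A (diag_sum A P Q') R)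
        (diag_sum A (diag_sum A P' (zero_proj A)) R)" by blast
    from mvn_trace[OF this] show ?thesis using r
      by (simp add: trace_diag_sum trace_zero_proj algebra_simps)
  qed
  have "(THE r'. \<forall>(P, Q)\<in>?x. complex_of_real r' = mat_trace tr P - mat_trace tr Q) = r"
  proof (rule the_equality)
    show "\<forall>(P, Q)\<in>?x. complex_of_real r = mat_trace tr P - mat_trace tr Q"
      using all_x by auto
    fix r' assume "\<forall>(P, Q)\<in>?x. complex_of_real r' = mat_trace tr P - mat_trace tr Q"
    then have "complex_of_real r' = complex_of_real r" using in_x all_x[OF in_x] by fastforce
    then show "r' = r" by simp
  qed
  ultimately show ?thesis by (simp add: K0_trace_def K0_class_def)
qed

lemma K0_trace_clique_proj:
  assumes C: "C \<in> cliques S m"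
  shows "K0_trace A (natural_trace S m) (K0_class A (mat1 A (clique_proj S m q C)))
    = (\<Prod>s\<in>C. 1 / (1 + q s))"
proof -
  note p = clique_proj_props[OF C subset_refl]
  have "mat_trace tr (mat1 A (clique_proj S m q C)) = tr (clique_proj S m q C)"
    by (simp add: mat_trace_def mat1_def)
  then have "K0_trace A tr (K0_class A (mat1 A (clique_proj S m q C))) = (\<Prod>s\<in>C. 1 / (1 + q s))"
    using p(6) by (intro K0_trace_class mat1_proj p(1-3)) simp
  moreover have "natural_trace S m = tr" using natural_trace_eq by blast
  ultimately show ?thesis by simp
qed

end

theorem proposition4p6:
  fixes S :: "'a set" and m :: "'a \<Rightarrow> 'a \<Rightarrow> enat" and q :: "'a \<Rightarrow> real"
  assumes "right_angled_coxeter_matrix S m"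
    and "\<forall>s\<in>S. 0 < q s \<and> q s \<le> 1"
  shows "\<forall>C\<in>cliques S m.
    K0_trace (hecke_cstar S m q) (natural_trace S m)
      (K0_class (hecke_cstar S m q) (mat1 (hecke_cstar S m q) (clique_proj S m q C)))
    = (\<Prod>s\<in>C. 1 / (1 + q s))"
proof -
  interpret right_angled_hecke S m q using assms by unfold_locales auto
  show ?thesis using K0_trace_clique_proj by blast
qed

end
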